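(* Let $k$ be $\mathbb{Z}$ or $\mathbb{R}$, and let $A$ and $B$ be pm-rings equipped with $k$-algebra structures. Then there is a group isomorphism $$\pi_{k}^{alg}(A\times B)\cong\pi_{k}^{alg}(A)\times\pi_{k}^{alg}(B).$$
   Context: All rings are commutative with unity. A pm-ring is a ring in which every prime ideal is contained in a unique maximal ideal. $\mathrm{Spec}(A)$ carries the Zariski topology and $\mathrm{Max}(A)$ the subspace topology; for a pm-ring $A$ let $\mu:\mathrm{Spec}(A)\to\mathrm{Max}(A)$ send each prime to the unique maximal ideal containing it (this is a continuous retraction, and $\mathrm{Max}(A)$ is compact Hausdorff). Let $k$ be $\mathbb{Z}$ or $\mathbb{R}$. $E_k(A)$ is the monoid of unital $k$-algebra endomorphisms of $A$. For $f\in E_k(A)$, the induced spectral map $\mu_f:\mathrm{Max}(A)\to\mathrm{Max}(A)$ is the continuous map $\mu_f(M)=\mu(f^{-1}(M))$. Put $X_k^A=\{\mu_f : f\in E_k(A)\}$, with the subspace topology from the space $C(\mathrm{Max}(A),\mathrm{Max}(A))$ of continuous self-maps with the compact-open topology. The spectral fundamental group of $A$ is $\pi_k^{alg}(A):=\pi_1(X_k^A,\mu_{id_A})$, i.e. based-homotopy classes of loops in $X_k^A$ at $\mu_{id_A}$ (the identity map of $\mathrm{Max}(A)$), with the operation induced by concatenation. $A\times B$ is the product $k$-algebra. *)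

theory Defs
  imports "HOL-Algebra.Module" "HOL-Algebra.Chinese_Remainder" "HOL-Algebra.IntRing"
    "HOL-Analysis.Homotopy" "HOL-Analysis.Function_Topology"
begin

hide_const (open) Multiset.mult

section \<open>Scalars and algebras\<close>

abbreviation real_ring :: "real ring"
  where "real_ring \<equiv> \<lparr>carrier = UNIV, mult = (*), one = 1, zero = 0, add = (+)\<rparr>"

definition alg_prod :: "('k, 'a) module \<Rightarrow> ('k, 'b) module \<Rightarrow> ('k, 'a \<times> 'b) module"
  where "alg_prod A B =
    ring.extend (RDirProd A B) \<lparr>smult = (\<lambda>r (a, b). (r \<odot>\<^bsub>A\<^esub> a, r \<odot>\<^bsub>B\<^esub> b))\<rparr>"

text \<open>
  The endomorphisms are required to be extensional, so that the set below contains every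
  endomorphism exactly once although HOL functions are total.
\<close>

definition alg_End :: "('k, 'm) ring_scheme \<Rightarrow> ('k, 'a) module \<Rightarrow> ('a \<Rightarrow> 'a) set"
  where "alg_End K A = {f \<in> ring_hom A A \<inter> extensional (carrier A).
    \<forall>r \<in> carrier K. \<forall>a \<in> carrier A. f (r \<odot>\<^bsub>A\<^esub> a) = r \<odot>\<^bsub>A\<^esub> f a}"

section \<open>Prime and maximal spectra\<close>

definition Spec :: "('a, 'm) ring_scheme \<Rightarrow> 'a set set"
  where "Spec A = {P. primeideal P A}"

definition Max_Spec :: "('a, 'm) ring_scheme \<Rightarrow> 'a set set"
  where "Max_Spec A = {M. maximalideal M A}"

text \<open>The open sets are the complements of the sets of all primes containing a given \<open>S\<close>.\<close>

definition zariski :: "('a, 'm) ring_scheme \<Rightarrow> 'a set topology"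
  where "zariski A = topology (\<lambda>U. \<exists>S \<subseteq> carrier A. U = Spec A - {P. S \<subseteq> P})"

lemma istopology_zariski:
  assumes "cring A"
  shows "istopology (\<lambda>U. \<exists>S \<subseteq> carrier A. U = Spec A - {P. S \<subseteq> P})"
  unfolding istopology_def
proof (intro conjI allI impI)
  fix U V
  assume "\<exists>S \<subseteq> carrier A. U = Spec A - {P. S \<subseteq> P}" "\<exists>S \<subseteq> carrier A. V = Spec A - {P. S \<subseteq> P}"
  then obtain S T where S: "S \<subseteq> carrier A" "U = Spec A - {P. S \<subseteq> P}"
    and T: "T \<subseteq> carrier A" "V = Spec A - {P. T \<subseteq> P}" by auto
  interpret cring A by fact
  define W where "W = {s \<otimes>\<^bsub>A\<^esub> t | s t. s \<in> S \<and> t \<in> T}"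
  have "W \<subseteq> P \<longleftrightarrow> S \<subseteq> P \<or> T \<subseteq> P" if "primeideal P A" for P
  proof -
    interpret primeideal P A by fact
    show ?thesis
    proof
      assume W: "W \<subseteq> P"
      show "S \<subseteq> P \<or> T \<subseteq> P"
      proof (rule ccontr)
        assume "\<not> (S \<subseteq> P \<or> T \<subseteq> P)"
        then obtain s t where "s \<in> S" "s \<notin> P" "t \<in> T" "t \<notin> P" by blast
        moreover have "s \<otimes>\<^bsub>A\<^esub> t \<in> P" using W calculation by (auto simp: W_def)
        ultimately show False using I_prime S T by blast
      qed
    next
      assume "S \<subseteq> P \<or> T \<subseteq> P"
      then show "W \<subseteq> P" using S T by (auto simp: W_def intro: I_l_closed I_r_closed)
    qed
  qed
  then have "U \<inter> V = Spec A - {P. W \<subseteq> P}" using S T by (auto simp: Spec_def)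
  moreover have "W \<subseteq> carrier A" using S T by (auto simp: W_def)
  ultimately show "\<exists>S \<subseteq> carrier A. U \<inter> V = Spec A - {P. S \<subseteq> P}" by blast
next
  fix \<U>
  assume "\<forall>U \<in> \<U>. \<exists>S \<subseteq> carrier A. U = Spec A - {P. S \<subseteq> P}"
  then obtain S where S: "\<And>U. U \<in> \<U> \<Longrightarrow> S U \<subseteq> carrier A \<and> U = Spec A - {P. S U \<subseteq> P}"
    by metis
  have "x \<in> \<Union>\<U> \<longleftrightarrow> x \<in> Spec A - {P. \<Union>(S ` \<U>) \<subseteq> P}" for x
  proof -
    have "x \<in> U \<longleftrightarrow> x \<in> Spec A \<and> \<not> S U \<subseteq> x" if "U \<in> \<U>" for U
      using S[OF that] by blast
    then show ?thesis by (simp add: Union_iff UN_subset_iff)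
  qed
  then have "\<Union>\<U> = Spec A - {P. \<Union>(S ` \<U>) \<subseteq> P}" by blast
  moreover have "\<Union>(S ` \<U>) \<subseteq> carrier A" using S by blast
  ultimately show "\<exists>S \<subseteq> carrier A. \<Union>\<U> = Spec A - {P. S \<subseteq> P}" by blast
qed

definition max_space :: "('a, 'm) ring_scheme \<Rightarrow> 'a set topology"
  where "max_space A = subtopology (zariski A) (Max_Spec A)"

locale pm_ring = cring R for R (structure) +
  assumes unique_maximal: "P \<in> Spec R \<Longrightarrow> \<exists>!M. M \<in> Max_Spec R \<and> P \<subseteq> M"

definition retr :: "('a, 'm) ring_scheme \<Rightarrow> 'a set \<Rightarrow> 'a set"
  where "retr A P = (THE M. M \<in> Max_Spec A \<and> P \<subseteq> M)"

definition spectral_map :: "('a, 'm) ring_scheme \<Rightarrow> ('a \<Rightarrow> 'a) \<Rightarrow> ('a set \<Rightarrow> 'a set)"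
  where "spectral_map A f = (\<lambda>M \<in> Max_Spec A. retr A (f -` M \<inter> carrier A))"

section \<open>Compact-open topology\<close>

definition cmaps :: "'a topology \<Rightarrow> 'b topology \<Rightarrow> ('a \<Rightarrow> 'b) set"
  where "cmaps X Y = {f \<in> extensional (topspace X). continuous_map X Y f}"

definition compact_open :: "'a topology \<Rightarrow> 'b topology \<Rightarrow> ('a \<Rightarrow> 'b) topology"
  where "compact_open X Y =
    topology_generated_by {{f \<in> cmaps X Y. f ` C \<subseteq> U} | C U. compactin X C \<and> openin Y U}"

lemma topspace_compact_open: "topspace (compact_open X Y) = cmaps X Y"
proof -
  have "{f \<in> cmaps X Y. f ` {} \<subseteq> {}} \<in>
      {{f \<in> cmaps X Y. f ` C \<subseteq> U} | C U. compactin X C \<and> openin Y U}"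
    using compactin_empty openin_empty by blast
  then show ?thesis
    unfolding compact_open_def topology_generated_by_topspace by auto
qed

section \<open>Fundamental group of an arbitrary topological space\<close>

text \<open>
  Loops are functions on all of \<open>\<real>\<close>, but only their values on \<open>{0..1}\<close> matter: the homotopy
  relation identifies loops that agree there.
\<close>

definition loops :: "'a topology \<Rightarrow> 'a \<Rightarrow> (real \<Rightarrow> 'a) set"
  where "loops X x = {p. pathin X p \<and> p 0 = x \<and> p 1 = x}"

definition loop_homotopy :: "'a topology \<Rightarrow> 'a \<Rightarrow> ((real \<Rightarrow> 'a) \<times> (real \<Rightarrow> 'a)) set"
  where "loop_homotopy X x = {(p, q). p \<in> loops X x \<and> q \<in> loops X x \<and>
    homotopic_with (\<lambda>h. h 0 = x \<and> h 1 = x) (top_of_set {0..1}) X p q}"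

definition concat_loops :: "(real \<Rightarrow> 'a) \<Rightarrow> (real \<Rightarrow> 'a) \<Rightarrow> (real \<Rightarrow> 'a)"
  where "concat_loops p q = (\<lambda>t. if t \<le> 1/2 then p (2 * t) else q (2 * t - 1))"

definition fundamental_group :: "'a topology \<Rightarrow> 'a \<Rightarrow> (real \<Rightarrow> 'a) set monoid"
  where "fundamental_group X x =
    \<lparr>carrier = loops X x // loop_homotopy X x,
     mult = (\<lambda>a b. \<Union>p \<in> a. \<Union>q \<in> b. loop_homotopy X x `` {concat_loops p q}),
     one = loop_homotopy X x `` {\<lambda>_. x}\<rparr>"

section \<open>The spectral fundamental group\<close>

definition spectral_space ::
    "('k, 'm) ring_scheme \<Rightarrow> ('k, 'a) module \<Rightarrow> ('a set \<Rightarrow> 'a set) topology"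
  where "spectral_space K A =
    subtopology (compact_open (max_space A) (max_space A)) (spectral_map A ` alg_End K A)"

definition pi_alg ::
    "('k, 'm) ring_scheme \<Rightarrow> ('k, 'a) module \<Rightarrow> (real \<Rightarrow> 'a set \<Rightarrow> 'a set) set monoid"
  where "pi_alg K A =
    fundamental_group (spectral_space K A) (spectral_map A (\<lambda>a \<in> carrier A. a))"

end

theory Submission
  imports Defs "HOL-Analysis.Abstract_Topological_Spaces" "HOL-Algebra.Ring_Divisibility"
begin

text \<open>
  A maximal ideal of \<open>A \<times> B\<close> is \<open>M \<times> B\<close> or \<open>A \<times> N\<close>, so \<open>Max (A \<times> B)\<close> is the disjoint union of
  open copies of \<open>Max A\<close> and \<open>Max B\<close>. An endomorphism of \<open>A \<times> B\<close> may mix the two factors, and its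
  spectral map may then move points from one copy to the other, so the space of spectral maps of
  \<open>A \<times> B\<close> can be larger than the product of the two spaces. The difference is invisible to loops
  based at the identity: for a fixed point \<open>s\<close> of \<open>Max (A \<times> B)\<close>, evaluation at \<open>s\<close> is continuous, so
  the set of maps sending \<open>s\<close> to its own copy is clopen. Hence a loop at the identity, or a homotopy
  of such loops, never leaves the subspace of maps that preserve both copies
  (\<open>fundamental_group_Inter_clopen\<close>).

  Restricting a map to the two copies is a homeomorphism from this subspace onto a product of mapping
  spaces (\<open>homeomorphic_split_maps\<close>). Under it the spectral maps of \<open>A \<times> B\<close> that preserve both copies
  correspond exactly to the pairs of spectral maps of \<open>A\<close> and \<open>B\<close> (\<open>spectral_map_split_iff\<close>). The
  algebraic core is that an endomorphism \<open>f\<close> with such a spectral map is a product \<open>f1 \<times> f2\<close>: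
  the first component of \<open>f (0, 1)\<close> is an idempotent of \<open>A\<close> that lies in every maximal ideal, so it is
  \<open>0\<close> (\<open>preserves_kernel\<close>). It remains to use that \<open>\<pi>\<^sub>1\<close> carries products to products
  (\<open>fundamental_group_homeomorphic_prod\<close>).
\<close>

section \<open>Fundamental groups\<close>

lemma loop_homotopy_iff:
  "(p, q) \<in> loop_homotopy X x \<longleftrightarrow> p \<in> loops X x \<and> q \<in> loops X x \<and>
    (\<exists>h. continuous_map (top_of_set ({0..1} \<times> {0..1})) X h \<and>
      (\<forall>t \<in> {0..1}. h (0, t) = p t \<and> h (1, t) = q t \<and> h (t, 0) = x \<and> h (t, 1) = x))"
  unfolding loop_homotopy_def by (subst homotopic_with) auto

lemma loop_homotopy_refl: "p \<in> loops X x \<Longrightarrow> (p, p) \<in> loop_homotopy X x"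
  by (auto simp: loop_homotopy_def loops_def pathin_def)

lemma equiv_loop_homotopy: "equiv (loops X x) (loop_homotopy X x)"
proof (rule equivI)
  show "loop_homotopy X x \<subseteq> loops X x \<times> loops X x"
    by (auto simp: loop_homotopy_def)
  show "refl_on (loops X x) (loop_homotopy X x)"
    by (simp add: refl_on_def loop_homotopy_refl)
  show "sym (loop_homotopy X x)"
    by (auto simp: sym_def loop_homotopy_def intro: homotopic_with_symD)
  show "trans (loop_homotopy X x)"
    by (auto simp: trans_def loop_homotopy_def intro: homotopic_with_trans)
qed

text \<open>
  Two squares whose right and left edges agree are pasted and rescaled. This serves both concatenated
  loops (the edges of the square) and concatenated homotopies.
\<close>

lemma continuous_map_concat:
  fixes f g :: "real \<times> real \<Rightarrow> 'a"
  assumes f: "continuous_map (top_of_set ({0..1} \<times> {0..1})) X f"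
    and g: "continuous_map (top_of_set ({0..1} \<times> {0..1})) X g"
    and fg: "\<And>s. s \<in> {0..1} \<Longrightarrow> f (s, 1) = g (s, 0)"
  shows "continuous_map (top_of_set ({0..1} \<times> {0..1})) X
    (\<lambda>z. if snd z \<le> (1/2::real) then f (fst z, 2 * snd z) else g (fst z, 2 * snd z - 1))"
proof -
  let ?I = "{0..1::real}"
  show ?thesis
  proof (rule continuous_map_cases_le)
    have "continuous_map (top_of_set (?I \<times> ?I \<inter> {z. snd z \<le> 1/2})) X (f \<circ> (\<lambda>z. (fst z, 2 * snd z)))"
      by (rule continuous_map_compose[OF _ f])
        (auto simp: continuous_map_in_subtopology intro!: continuous_on_Pair continuous_on_fst
          continuous_on_mult continuous_on_diff continuous_on_snd continuous_on_const continuous_on_id)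
    then show "continuous_map
       (subtopology (top_of_set (?I \<times> ?I)) {z \<in> topspace (top_of_set (?I \<times> ?I)). snd z \<le> 1/2})
       X (\<lambda>z. f (fst z, 2 * snd z))"
      by (simp add: subtopology_subtopology o_def Int_def)
    have "continuous_map (top_of_set (?I \<times> ?I \<inter> {z. 1/2 \<le> snd z})) X (g \<circ> (\<lambda>z. (fst z, 2 * snd z - 1)))"
      by (rule continuous_map_compose[OF _ g])
        (auto simp: continuous_map_in_subtopology intro!: continuous_on_Pair continuous_on_fst
          continuous_on_mult continuous_on_diff continuous_on_snd continuous_on_const continuous_on_id)
    then show "continuous_map
       (subtopology (top_of_set (?I \<times> ?I)) {z \<in> topspace (top_of_set (?I \<times> ?I)). 1/2 \<le> snd z})
       X (\<lambda>z. g (fst z, 2 * snd z - 1))"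
      by (simp add: subtopology_subtopology o_def Int_def)
    fix z assume "z \<in> topspace (top_of_set (?I \<times> ?I))" "snd z = 1/2"
    then show "f (fst z, 2 * snd z) = g (fst z, 2 * snd z - 1)"
      using fg[of "fst z"] by (auto simp: mult.commute)
  qed (simp_all add: continuous_on_snd continuous_on_id)
qed

lemma loop_homotopy_concat:
  assumes "(p, p') \<in> loop_homotopy X x" and "(q, q') \<in> loop_homotopy X x"
  shows "(concat_loops p q, concat_loops p' q') \<in> loop_homotopy X x"
proof -
  let ?I = "{0..1::real}"
  let ?II = "top_of_set (?I \<times> ?I)"
  obtain h where h: "continuous_map ?II X h"
      "\<forall>t \<in> ?I. h (0, t) = p t \<and> h (1, t) = p' t \<and> h (t, 0) = x \<and> h (t, 1) = x"
    using assms(1) by (auto simp: loop_homotopy_iff)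
  obtain k where k: "continuous_map ?II X k"
      "\<forall>t \<in> ?I. k (0, t) = q t \<and> k (1, t) = q' t \<and> k (t, 0) = x \<and> k (t, 1) = x"
    using assms(2) by (auto simp: loop_homotopy_iff)
  define H where
    "H = (\<lambda>z. if snd z \<le> (1/2::real) then h (fst z, 2 * snd z) else k (fst z, 2 * snd z - 1))"
  have H: "continuous_map ?II X H"
    unfolding H_def by (rule continuous_map_concat) (use h k in auto)
  have ends: "H (0, t) = concat_loops p q t" "H (1, t) = concat_loops p' q' t"
    "H (t, 0) = x" "H (t, 1) = x" if "t \<in> ?I" for t
    using that h k by (auto simp: H_def concat_loops_def)
  have slice: "pathin X (\<lambda>t. H (s, t))" if "s \<in> ?I" for s
    using continuous_map_o_Pair[of "top_of_set ?I" "top_of_set ?I", of X H s] H that by (simp add: pathin_def o_def)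
  have "pathin X (concat_loops p q)" "pathin X (concat_loops p' q')"
    using slice[of 0] slice[of 1] ends(1,2) unfolding pathin_def
    by (fastforce elim: continuous_map_eq)+
  then have "concat_loops p q \<in> loops X x" "concat_loops p' q' \<in> loops X x"
    using assms by (simp_all add: loops_def loop_homotopy_iff concat_loops_def)
  then show ?thesis
    using H ends unfolding loop_homotopy_iff by blast
qed

lemma concat_in_loops:
  assumes "p \<in> loops X x" and "q \<in> loops X x"
  shows "concat_loops p q \<in> loops X x"
  using loop_homotopy_concat[OF assms[THEN loop_homotopy_refl]]
  by (simp add: loop_homotopy_iff)

lemma fundamental_group_mult:
  assumes p: "p \<in> loops X x" and q: "q \<in> loops X x"
  shows "loop_homotopy X x `` {p} \<otimes>\<^bsub>fundamental_group X x\<^esub> loop_homotopy X x `` {q}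
    = loop_homotopy X x `` {concat_loops p q}"
proof -
  let ?r = "loop_homotopy X x"
  have same: "?r `` {concat_loops p' q'} = ?r `` {concat_loops p q}"
    if "p' \<in> ?r `` {p}" "q' \<in> ?r `` {q}" for p' q'
  proof (rule equiv_class_eq[OF equiv_loop_homotopy, symmetric])
    show "(concat_loops p q, concat_loops p' q') \<in> ?r"
      using that by (intro loop_homotopy_concat) simp_all
  qed
  have ne: "?r `` {p} \<noteq> {}" "?r `` {q} \<noteq> {}"
    using loop_homotopy_refl[OF p] loop_homotopy_refl[OF q] by auto
  have "(\<Union>p' \<in> ?r `` {p}. \<Union>q' \<in> ?r `` {q}. ?r `` {concat_loops p' q'})
      = (\<Union>p' \<in> ?r `` {p}. \<Union>q' \<in> ?r `` {q}. ?r `` {concat_loops p q})"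
    by (intro SUP_cong refl same)
  also have "\<dots> = ?r `` {concat_loops p q}"
    using ne by (simp only: UN_constant if_False)
  finally show ?thesis
    by (simp only: fundamental_group_def monoid.simps)
qed

text \<open>
  A first isomorphism theorem at the level of loops: to identify the fundamental group with \<open>H\<close>, it is
  enough to give a map on loops that turns concatenation into multiplication and whose fibres are the
  homotopy classes.
\<close>

lemma fundamental_group_isoI:
  assumes closed: "\<And>p. p \<in> loops X x \<Longrightarrow> \<phi> p \<in> carrier H"
    and kernel: "\<And>p q. p \<in> loops X x \<Longrightarrow> q \<in> loops X x \<Longrightarrow>
      \<phi> p = \<phi> q \<longleftrightarrow> (p, q) \<in> loop_homotopy X x"
    and onto: "\<And>c. c \<in> carrier H \<Longrightarrow> \<exists>p \<in> loops X x. \<phi> p = c"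
    and mult: "\<And>p q. p \<in> loops X x \<Longrightarrow> q \<in> loops X x \<Longrightarrow>
      \<phi> (concat_loops p q) = \<phi> p \<otimes>\<^bsub>H\<^esub> \<phi> q"
  shows "fundamental_group X x \<cong> H"
proof -
  let ?r = "loop_homotopy X x"
  define \<Phi> where "\<Phi> a = \<phi> (SOME p. p \<in> a)" for a
  have \<Phi>: "\<Phi> (?r `` {p}) = \<phi> p" if p: "p \<in> loops X x" for p
  proof -
    have "(p, SOME q. (p, q) \<in> ?r) \<in> ?r"
      using loop_homotopy_refl[OF p] by (rule someI[of "\<lambda>q. (p, q) \<in> ?r"])
    then have "(p, SOME q. q \<in> ?r `` {p}) \<in> ?r" by simp
    then show ?thesis
      unfolding \<Phi>_def using kernel p by (metis loop_homotopy_iff)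
  qed
  have carr: "carrier (fundamental_group X x) = loops X x // ?r"
    by (simp add: fundamental_group_def)
  have "\<Phi> \<in> hom (fundamental_group X x) H"
    unfolding hom_def carr
    by (auto elim!: quotientE simp: \<Phi> closed mult fundamental_group_mult concat_in_loops)
  moreover have "inj_on \<Phi> (loops X x // ?r)"
    by (auto elim!: quotientE simp: inj_on_def \<Phi> kernel
        intro!: equiv_class_eq[OF equiv_loop_homotopy] simp del: Image_singleton_iff)
  moreover have "\<Phi> ` (loops X x // ?r) = carrier H"
  proof
    show "\<Phi> ` (loops X x // ?r) \<subseteq> carrier H"
      by (auto elim!: quotientE simp: \<Phi> closed)
    show "carrier H \<subseteq> \<Phi> ` (loops X x // ?r)"
      using onto \<Phi> by (metis image_eqI quotientI subsetI)
  qed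
  ultimately show ?thesis
    by (auto simp: is_iso_def iso_def bij_betw_def carr)
qed

text \<open>
  A connected set cannot leave any clopen set that it meets, so it cannot leave an intersection of
  clopen sets either, although such an intersection need not be open.
\<close>

lemma connectedin_subset_Inter_clopen:
  assumes "connectedin X C" and "x \<in> C" and "x \<in> \<Inter>\<T>"
    and "\<And>T. T \<in> \<T> \<Longrightarrow> openin X T \<and> closedin X T"
  shows "C \<subseteq> \<Inter>\<T>"
proof (rule Inter_greatest)
  fix T assume "T \<in> \<T>"
  then have "C \<subseteq> T \<or> disjnt C T"
    using assms(1,4) connectedin_clopen_cases by blast
  moreover have "\<not> disjnt C T"
    using assms(2,3) \<open>T \<in> \<T>\<close> by (auto simp: disjnt_iff)
  ultimately show "C \<subseteq> T" by blast
qed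

lemma continuous_map_into_Inter_clopen:
  assumes f: "continuous_map Z X f" and Z: "connected_space Z"
    and z: "z \<in> topspace Z" "f z \<in> \<Inter>\<T>"
    and \<T>: "\<And>T. T \<in> \<T> \<Longrightarrow> openin X T \<and> closedin X T"
  shows "continuous_map Z (subtopology X (\<Inter>\<T>)) f"
proof -
  have "connectedin X (f ` topspace Z)"
    using f Z by (simp add: connectedin_continuous_map_image connectedin_topspace)
  then have "f ` topspace Z \<subseteq> \<Inter>\<T>"
    by (rule connectedin_subset_Inter_clopen) (use z \<T> in auto)
  then show ?thesis
    using f by (simp add: continuous_map_in_subtopology image_subset_iff_funcset)
qed

text \<open>
  The interval and the square are connected, so loops and homotopies through \<open>x\<close> stay in
  \<open>\<Inter>\<T>\<close>. The two groups consist of the same functions modulo the same relation, whence an equality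
  and not just an isomorphism.
\<close>

lemma fundamental_group_Inter_clopen:
  assumes clopen: "\<And>T. T \<in> \<T> \<Longrightarrow> openin X T \<and> closedin X T"
    and x: "x \<in> \<Inter>\<T>"
  shows "fundamental_group (subtopology X (\<Inter>\<T>)) x = fundamental_group X x"
proof -
  let ?I = "{0..1::real}"
  let ?Y = "subtopology X (\<Inter>\<T>)"
  have I: "connected_space (top_of_set ?I)"
    using convex_connected[OF convex_real_interval(5)] by (simp only: connected_space_subtopology connectedin_iff_connected)
  have II: "connected_space (top_of_set (?I \<times> ?I))"
    by (simp add: connected_space_subtopology connected_Times)
  have cont_I: "continuous_map (top_of_set ?I) ?Y p"
    if "continuous_map (top_of_set ?I) X p" "p 0 = x" for p
    by (rule continuous_map_into_Inter_clopen[OF that(1) I _ _ clopen, of 0]) (use that x in auto)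
  have cont_II: "continuous_map (top_of_set (?I \<times> ?I)) ?Y h"
    if "continuous_map (top_of_set (?I \<times> ?I)) X h" "h (0, 0) = x" for h
    by (rule continuous_map_into_Inter_clopen[OF that(1) II _ _ clopen, of "(0, 0)"])
      (use that x in auto)
  have loops_eq: "loops ?Y x = loops X x"
    using cont_I by (auto simp: loops_def pathin_def continuous_map_in_subtopology)
  have "(p, q) \<in> loop_homotopy ?Y x \<longleftrightarrow> (p, q) \<in> loop_homotopy X x" for p q
  proof
    assume "(p, q) \<in> loop_homotopy ?Y x"
    then show "(p, q) \<in> loop_homotopy X x"
      unfolding loop_homotopy_iff loops_eq continuous_map_in_subtopology by blast
  next
    assume "(p, q) \<in> loop_homotopy X x"
    then obtain h where h: "continuous_map (top_of_set (?I \<times> ?I)) X h"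
        "\<forall>t \<in> ?I. h (0, t) = p t \<and> h (1, t) = q t \<and> h (t, 0) = x \<and> h (t, 1) = x"
      and pq: "p \<in> loops X x" "q \<in> loops X x"
      unfolding loop_homotopy_iff by blast
    have "h (0, 0) = x" using h(2) by simp
    then show "(p, q) \<in> loop_homotopy ?Y x"
      unfolding loop_homotopy_iff loops_eq using cont_II[OF h(1)] h(2) pq by blast
  qed
  then have "loop_homotopy ?Y x = loop_homotopy X x" by auto
  with loops_eq show ?thesis
    by (simp add: fundamental_group_def)
qed

lemma loops_compose:
  assumes "continuous_map X Y f" and "p \<in> loops X x"
  shows "f \<circ> p \<in> loops Y (f x)"
  using assms by (auto simp: loops_def pathin_compose)

lemma loop_homotopy_compose:
  assumes "continuous_map X Y f" and "(p, q) \<in> loop_homotopy X x"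
  shows "(f \<circ> p, f \<circ> q) \<in> loop_homotopy Y (f x)"
  using assms unfolding loop_homotopy_def
  by (auto simp: loops_compose elim!: homotopic_with_compose_continuous_map_left)

lemma concat_loops_compose: "f \<circ> concat_loops p q = concat_loops (f \<circ> p) (f \<circ> q)"
  by (auto simp: concat_loops_def)

text \<open>
  A loop in a product is a pair of loops, and a homotopy is a pair of homotopies. The homeomorphism
  \<open>h\<close> is built in, so that the product structure can be read off from any space homeomorphic to a
  product.
\<close>

lemma fundamental_group_homeomorphic_prod:
  assumes h: "homeomorphic_map X (prod_topology Y Z) h" and hx: "h x = (y, z)" and x: "x \<in> topspace X"
  shows "fundamental_group X x \<cong> fundamental_group Y y \<times>\<times> fundamental_group Z z"
proof -
  obtain k where k: "homeomorphic_maps X (prod_topology Y Z) h k"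
    using h homeomorphic_map_maps by blast
  have conth: "continuous_map X Y (fst \<circ> h)" "continuous_map X Z (snd \<circ> h)"
    and contk: "continuous_map (prod_topology Y Z) X k"
    and kh: "\<And>u. u \<in> topspace X \<Longrightarrow> k (h u) = u"
    and hk: "\<And>u. u \<in> topspace (prod_topology Y Z) \<Longrightarrow> h (k u) = u"
    using k by (auto simp: homeomorphic_maps_def continuous_map_pairwise)
  have kx: "k (y, z) = x" using kh[OF x] hx by simp
  let ?I = "top_of_set {0..1::real}"
  have pair_loop: "(\<lambda>t. k (p t, q t)) \<in> loops X x" if "p \<in> loops Y y" "q \<in> loops Z z" for p q
  proof -
    have "continuous_map ?I X (k \<circ> (\<lambda>t. (p t, q t)))"
      using that by (intro continuous_map_compose[OF _ contk])
        (auto simp: continuous_map_pairwise o_def loops_def pathin_def)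
    then show ?thesis using that kx by (simp add: loops_def pathin_def o_def)
  qed
  have loop_in: "p t \<in> topspace W" if "p \<in> loops W w" "t \<in> {0..1}" for p t and W :: "'d topology" and w
    using that by (auto simp: loops_def pathin_def continuous_map_def)
  \<comment> \<open>Loops are functions on the whole real line, so \<open>h \<circ> k\<close> reproduces a loop only on the unit
    interval; this is enough for homotopy classes.\<close>
  have hom_eq: "(p, q) \<in> loop_homotopy W w"
    if "p \<in> loops W w" "q \<in> loops W w" "\<And>t. t \<in> {0..1} \<Longrightarrow> p t = q t" for p q and W :: "'d topology" and w
    using that unfolding loop_homotopy_def
    by (auto intro!: homotopic_with_equal simp: loops_def pathin_def)
  define \<phi> where "\<phi> p = (loop_homotopy Y y `` {fst \<circ> h \<circ> p}, loop_homotopy Z z `` {snd \<circ> h \<circ> p})" for p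
  have comp: "fst \<circ> h \<circ> p \<in> loops Y y" "snd \<circ> h \<circ> p \<in> loops Z z" if "p \<in> loops X x" for p
    using loops_compose[OF conth(1) that] loops_compose[OF conth(2) that] hx by auto
  note class_eq = eq_equiv_class_iff[OF equiv_loop_homotopy]
  show ?thesis
  proof (rule fundamental_group_isoI[where \<phi> = \<phi>])
    show "\<phi> p \<in> carrier (fundamental_group Y y \<times>\<times> fundamental_group Z z)" if "p \<in> loops X x" for p
      using comp[OF that] by (auto simp: \<phi>_def fundamental_group_def intro: quotientI)
  next
    fix p q assume p: "p \<in> loops X x" and q: "q \<in> loops X x"
    show "\<phi> p = \<phi> q \<longleftrightarrow> (p, q) \<in> loop_homotopy X x"
    proof
      assume "(p, q) \<in> loop_homotopy X x"
      then show "\<phi> p = \<phi> q"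
        using loop_homotopy_compose[OF conth(1), of p q x] loop_homotopy_compose[OF conth(2), of p q x] hx
        by (simp add: \<phi>_def class_eq comp p q)
    next
      assume "\<phi> p = \<phi> q"
      then have "(fst \<circ> h \<circ> p, fst \<circ> h \<circ> q) \<in> loop_homotopy Y y"
        and "(snd \<circ> h \<circ> p, snd \<circ> h \<circ> q) \<in> loop_homotopy Z z"
        by (simp_all add: \<phi>_def class_eq comp p q)
      then obtain F G where F: "continuous_map (top_of_set ({0..1} \<times> {0..1})) Y F"
          "\<forall>t \<in> {0..1}. F (0, t) = fst (h (p t)) \<and> F (1, t) = fst (h (q t)) \<and> F (t, 0) = y \<and> F (t, 1) = y"
        and G: "continuous_map (top_of_set ({0..1} \<times> {0..1})) Z G"
          "\<forall>t \<in> {0..1}. G (0, t) = snd (h (p t)) \<and> G (1, t) = snd (h (q t)) \<and> G (t, 0) = z \<and> G (t, 1) = z"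
        unfolding loop_homotopy_iff o_apply by blast
      have "continuous_map (top_of_set ({0..1} \<times> {0..1})) X (k \<circ> (\<lambda>u. (F u, G u)))"
        using F G by (intro continuous_map_compose[OF _ contk]) (auto simp: continuous_map_pairwise o_def)
      then show "(p, q) \<in> loop_homotopy X x"
        unfolding loop_homotopy_iff using F(2) G(2) p q
        by (intro conjI exI[of _ "k \<circ> (\<lambda>u. (F u, G u))"]) (auto simp: kx kh loop_in)
    qed
  next
    fix c assume "c \<in> carrier (fundamental_group Y y \<times>\<times> fundamental_group Z z)"
    then obtain p q where p: "p \<in> loops Y y" and q: "q \<in> loops Z z"
      and c: "c = (loop_homotopy Y y `` {p}, loop_homotopy Z z `` {q})"
      by (auto simp: fundamental_group_def elim!: quotientE)
    let ?r = "\<lambda>t. k (p t, q t)"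
    have r: "?r \<in> loops X x" by (rule pair_loop[OF p q])
    have "h (?r t) = (p t, q t)" if "t \<in> {0..1}" for t
      using hk loop_in[OF p that] loop_in[OF q that] by simp
    then have "(fst \<circ> h \<circ> ?r, p) \<in> loop_homotopy Y y" "(snd \<circ> h \<circ> ?r, q) \<in> loop_homotopy Z z"
      using comp[OF r] p q by (auto intro!: hom_eq)
    then have "\<phi> ?r = c"
      by (simp add: \<phi>_def c class_eq comp[OF r] p q)
    then show "\<exists>p \<in> loops X x. \<phi> p = c" using r by blast
  next
    fix p q assume "p \<in> loops X x" "q \<in> loops X x"
    then show "\<phi> (concat_loops p q) = \<phi> p \<otimes>\<^bsub>fundamental_group Y y \<times>\<times> fundamental_group Z z\<^esub> \<phi> q"
      by (simp add: \<phi>_def mult_DirProd' fundamental_group_mult comp concat_loops_compose)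
  qed
qed

section \<open>Mapping spaces of a disjoint union\<close>

lemma openin_compact_open:
  assumes "compactin X C" and "openin Y U"
  shows "openin (compact_open X Y) {f \<in> cmaps X Y. f ` C \<subseteq> U}"
  unfolding compact_open_def by (rule topology_generated_by_Basis) (use assms in blast)

lemma continuous_map_into_compact_open:
  assumes into: "\<And>t. t \<in> topspace T \<Longrightarrow> F t \<in> cmaps X Y"
    and pre: "\<And>C U. compactin X C \<Longrightarrow> openin Y U \<Longrightarrow> openin T {t \<in> topspace T. F t ` C \<subseteq> U}"
  shows "continuous_map T (compact_open X Y) F"
  unfolding compact_open_def
proof (rule continuous_on_generated_topo)
  fix W assume "W \<in> {{f \<in> cmaps X Y. f ` C \<subseteq> U} | C U. compactin X C \<and> openin Y U}"
  then obtain C U where W: "W = {f \<in> cmaps X Y. f ` C \<subseteq> U}" "compactin X C" "openin Y U" by blast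
  have "F -` W \<inter> topspace T = {t \<in> topspace T. F t ` C \<subseteq> U}"
    using into W(1) by blast
  then show "openin T (F -` W \<inter> topspace T)" using pre W by simp
next
  show "F ` topspace T \<subseteq> \<Union>{{f \<in> cmaps X Y. f ` C \<subseteq> U} | C U. compactin X C \<and> openin Y U}"
    using into topspace_compact_open[of X Y]
    unfolding compact_open_def topology_generated_by_topspace by blast
qed

lemma continuous_map_evaluation:
  assumes "x \<in> topspace X"
  shows "continuous_map (compact_open X Y) Y (\<lambda>f. f x)"
  unfolding continuous_map
proof (intro conjI allI impI)
  show "(\<lambda>f. f x) ` topspace (compact_open X Y) \<subseteq> topspace Y"
    using assms by (auto simp: topspace_compact_open cmaps_def continuous_map)
  fix U assume "openin Y U"
  then have "openin (compact_open X Y) {f \<in> cmaps X Y. f ` {x} \<subseteq> U}"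
    using assms by (intro openin_compact_open) (simp_all add: finite_imp_compactin)
  then show "openin (compact_open X Y) {f \<in> topspace (compact_open X Y). f x \<in> U}"
    by (simp add: topspace_compact_open)
qed

text \<open>
  A space \<open>S\<close> that is the disjoint union of open copies of \<open>X\<close> and \<open>Y\<close>, up to the embeddings \<open>i\<close> and
  \<open>j\<close>.
\<close>

locale open_decomposition =
  fixes X :: "'a topology" and Y :: "'b topology" and S :: "'s topology"
    and i :: "'a \<Rightarrow> 's" and j :: "'b \<Rightarrow> 's"
  assumes cont_i: "continuous_map X S i" and open_i: "open_map X S i" and inj_i: "inj_on i (topspace X)"
    and cont_j: "continuous_map Y S j" and open_j: "open_map Y S j" and inj_j: "inj_on j (topspace Y)"
    and cover: "topspace S = i ` topspace X \<union> j ` topspace Y"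
    and disjoint: "i ` topspace X \<inter> j ` topspace Y = {}"
begin

lemma swap: "open_decomposition Y X S j i"
  using cont_i open_i inj_i cont_j open_j inj_j cover disjoint
  by unfold_locales auto

lemma clopen_i: "openin S (i ` topspace X)" "closedin S (i ` topspace X)"
proof -
  show "openin S (i ` topspace X)" using open_i by (simp add: open_map_def)
  have "i ` topspace X = topspace S - j ` topspace Y" using cover disjoint by blast
  moreover have "openin S (j ` topspace Y)" using open_j by (simp add: open_map_def)
  ultimately show "closedin S (i ` topspace X)" by (simp add: closedin_diff)
qed

lemma continuous_map_from_pieces:
  "continuous_map S Z g \<longleftrightarrow> continuous_map X Z (g \<circ> i) \<and> continuous_map Y Z (g \<circ> j)"
proof
  assume "continuous_map S Z g"
  then show "continuous_map X Z (g \<circ> i) \<and> continuous_map Y Z (g \<circ> j)"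
    using cont_i cont_j by (simp add: continuous_map_compose)
next
  assume g: "continuous_map X Z (g \<circ> i) \<and> continuous_map Y Z (g \<circ> j)"
  show "continuous_map S Z g"
    unfolding continuous_map
  proof (intro conjI allI impI)
    show "g ` topspace S \<subseteq> topspace Z"
      using g unfolding cover continuous_map by (auto simp: image_Un image_image)
    fix U assume U: "openin Z U"
    have "{s \<in> topspace S. g s \<in> U} = i ` {x \<in> topspace X. (g \<circ> i) x \<in> U} \<union> j ` {y \<in> topspace Y. (g \<circ> j) y \<in> U}"
      unfolding cover by auto
    moreover have "openin S (i ` {x \<in> topspace X. (g \<circ> i) x \<in> U})"
      using open_i g U by (simp add: open_map_def continuous_map)
    moreover have "openin S (j ` {y \<in> topspace Y. (g \<circ> j) y \<in> U})"
      using open_j g U by (simp add: open_map_def continuous_map)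
    ultimately show "openin S {s \<in> topspace S. g s \<in> U}" by auto
  qed
qed

definition left_part :: "('s \<Rightarrow> 's) \<Rightarrow> 'a \<Rightarrow> 'a"
  where "left_part g = (\<lambda>x \<in> topspace X. inv_into (topspace X) i (g (i x)))"

definition right_part :: "('s \<Rightarrow> 's) \<Rightarrow> 'b \<Rightarrow> 'b"
  where "right_part g = (\<lambda>y \<in> topspace Y. inv_into (topspace Y) j (g (j y)))"

definition glue :: "('a \<Rightarrow> 'a) \<Rightarrow> ('b \<Rightarrow> 'b) \<Rightarrow> 's \<Rightarrow> 's"
  where "glue f h = (\<lambda>s \<in> topspace S. if s \<in> i ` topspace X
    then i (f (inv_into (topspace X) i s)) else j (h (inv_into (topspace Y) j s)))"

definition split_maps :: "('s \<Rightarrow> 's) set"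
  where "split_maps = {g \<in> cmaps S S. g ` i ` topspace X \<subseteq> i ` topspace X \<and>
    g ` j ` topspace Y \<subseteq> j ` topspace Y}"

lemma topspace_split_maps: "topspace (subtopology (compact_open S S) split_maps) = split_maps"
  by (auto simp: topspace_compact_open split_maps_def)

lemma i_left_part: "g \<in> split_maps \<Longrightarrow> x \<in> topspace X \<Longrightarrow> i (left_part g x) = g (i x)"
  by (auto simp: left_part_def split_maps_def intro!: f_inv_into_f)

lemma j_right_part: "g \<in> split_maps \<Longrightarrow> y \<in> topspace Y \<Longrightarrow> j (right_part g y) = g (j y)"
  by (auto simp: right_part_def split_maps_def intro!: f_inv_into_f)

lemma left_part_in: "g \<in> split_maps \<Longrightarrow> x \<in> topspace X \<Longrightarrow> left_part g x \<in> topspace X"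
  by (auto simp: left_part_def split_maps_def intro!: inv_into_into)

lemma glue_i: "x \<in> topspace X \<Longrightarrow> glue f h (i x) = i (f x)"
  using inj_i by (simp add: glue_def cover)

lemma glue_j: "y \<in> topspace Y \<Longrightarrow> glue f h (j y) = j (h y)"
  using inj_j disjoint by (auto simp: glue_def cover)

lemma left_part_cmaps:
  assumes g: "g \<in> split_maps"
  shows "left_part g \<in> cmaps X X"
proof -
  have "openin X {x \<in> topspace X. left_part g x \<in> U}" if U: "openin X U" for U
  proof -
    have "left_part g x \<in> U \<longleftrightarrow> (g \<circ> i) x \<in> i ` U" if x: "x \<in> topspace X" for x
      using inj_on_image_mem_iff[OF inj_i left_part_in[OF g x] openin_subset[OF U]] i_left_part[OF g x]
      by simp
    then have "{x \<in> topspace X. left_part g x \<in> U} = {x \<in> topspace X. (g \<circ> i) x \<in> i ` U}"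
      by blast
    moreover have "continuous_map X S (g \<circ> i)"
      by (rule continuous_map_compose[OF cont_i]) (use g in \<open>simp add: split_maps_def cmaps_def\<close>)
    ultimately show ?thesis
      using open_i U by (simp add: open_map_def continuous_map)
  qed
  then show ?thesis
    using left_part_in[OF g] by (auto simp: cmaps_def continuous_map left_part_def)
qed

text \<open>
  Because \<open>i\<close> is an open embedding, \<open>left_part g\<close> maps \<open>C\<close> into \<open>U\<close> exactly when \<open>g\<close> maps the compact
  set \<open>i ` C\<close> into the open set \<open>i ` U\<close>: subbasic sets pull back to subbasic sets.
\<close>

lemma continuous_left_part:
  "continuous_map (subtopology (compact_open S S) split_maps) (compact_open X X) left_part"
proof (rule continuous_map_into_compact_open)
  show "left_part g \<in> cmaps X X" if "g \<in> topspace (subtopology (compact_open S S) split_maps)" for g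
    using that left_part_cmaps by simp
  fix C U assume C: "compactin X C" and U: "openin X U"
  have CX: "C \<subseteq> topspace X" by (rule compactin_subset_topspace[OF C])
  have "left_part g ` C \<subseteq> U \<longleftrightarrow> g ` i ` C \<subseteq> i ` U" if g: "g \<in> split_maps" for g
  proof -
    have "left_part g x \<in> U \<longleftrightarrow> g (i x) \<in> i ` U" if "x \<in> C" for x
      using inj_on_image_mem_iff[OF inj_i left_part_in[OF g] openin_subset[OF U], of x]
        i_left_part[OF g, of x] that CX by auto
    then show ?thesis unfolding image_subset_iff by blast
  qed
  then have "{g \<in> topspace (subtopology (compact_open S S) split_maps). left_part g ` C \<subseteq> U}
      = split_maps \<inter> {g \<in> cmaps S S. g ` i ` C \<subseteq> i ` U}"
    unfolding topspace_split_maps using split_maps_def by blast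
  moreover have "openin (compact_open S S) {g \<in> cmaps S S. g ` i ` C \<subseteq> i ` U}"
    using image_compactin[OF C cont_i] open_i U by (intro openin_compact_open) (simp_all add: open_map_def)
  ultimately show "openin (subtopology (compact_open S S) split_maps)
      {g \<in> topspace (subtopology (compact_open S S) split_maps). left_part g ` C \<subseteq> U}"
    by (auto simp: openin_subtopology)
qed

end

text \<open>
  The hypotheses are symmetric in \<open>X\<close> and \<open>Y\<close>. The facts about \<open>X\<close> become facts about \<open>Y\<close> by
  interpreting the locale with exchanged roles.
\<close>

context open_decomposition
begin

interpretation swapped: open_decomposition Y X S j i
  by (rule swap)

lemma swapped_eq: "swapped.left_part = right_part" "swapped.split_maps = split_maps"
  by (auto simp: fun_eq_iff swapped.left_part_def right_part_def swapped.split_maps_def split_maps_def)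

lemma continuous_right_part:
  "continuous_map (subtopology (compact_open S S) split_maps) (compact_open Y Y) right_part"
  using swapped.continuous_left_part by (simp add: swapped_eq)

lemma clopen_j: "openin S (j ` topspace Y)" "closedin S (j ` topspace Y)"
  using swapped.clopen_i by auto

lemma glue_in_split_maps:
  assumes f: "f \<in> cmaps X X" and h: "h \<in> cmaps Y Y"
  shows "glue f h \<in> split_maps"
proof -
  have "continuous_map X S (glue f h \<circ> i)"
    by (rule continuous_map_eq[of _ _ "i \<circ> f"])
      (use f cont_i in \<open>auto simp: cmaps_def glue_i intro: continuous_map_compose\<close>)
  moreover have "continuous_map Y S (glue f h \<circ> j)"
    by (rule continuous_map_eq[of _ _ "j \<circ> h"])
      (use h cont_j in \<open>auto simp: cmaps_def glue_j intro: continuous_map_compose\<close>)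
  moreover have "f ` topspace X \<subseteq> topspace X" "h ` topspace Y \<subseteq> topspace Y"
    using f h by (auto simp: cmaps_def continuous_map)
  ultimately show ?thesis
    unfolding split_maps_def cmaps_def continuous_map_from_pieces
    by (auto simp: glue_i glue_j) (simp add: glue_def)
qed

lemma glue_parts:
  assumes g: "g \<in> split_maps"
  shows "glue (left_part g) (right_part g) = g"
proof (rule extensionalityI[where A = "topspace S"])
  show "glue (left_part g) (right_part g) \<in> extensional (topspace S)" by (simp add: glue_def)
  show "g \<in> extensional (topspace S)" using g by (simp add: split_maps_def cmaps_def)
  show "glue (left_part g) (right_part g) s = g s" if "s \<in> topspace S" for s
    using that i_left_part[OF g] j_right_part[OF g] by (auto simp: cover glue_i glue_j)
qed

lemma left_part_glue:
  assumes f: "f \<in> cmaps X X"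
  shows "left_part (glue f h) = f"
proof (rule extensionalityI[where A = "topspace X"])
  show "left_part (glue f h) \<in> extensional (topspace X)" by (simp add: left_part_def)
  show "f \<in> extensional (topspace X)" using f by (simp add: cmaps_def)
  show "left_part (glue f h) x = f x" if "x \<in> topspace X" for x
    using that f inj_i by (auto simp: left_part_def glue_i cmaps_def continuous_map)
qed

lemma right_part_glue:
  assumes h: "h \<in> cmaps Y Y"
  shows "right_part (glue f h) = h"
proof (rule extensionalityI[where A = "topspace Y"])
  show "right_part (glue f h) \<in> extensional (topspace Y)" by (simp add: right_part_def)
  show "h \<in> extensional (topspace Y)" using h by (simp add: cmaps_def)
  show "right_part (glue f h) y = h y" if "y \<in> topspace Y" for y
    using that h inj_j by (auto simp: right_part_def glue_j cmaps_def continuous_map)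
qed

text \<open>
  The copy of \<open>X\<close> is closed in \<open>S\<close>, so it cuts compact sets in compact sets.
\<close>

lemma compactin_preimage_i:
  assumes "compactin S C"
  shows "compactin X {x \<in> topspace X. i x \<in> C}"
proof -
  have "embedding_map X S i"
    using injective_open_imp_embedding_map cont_i open_i inj_i by blast
  then have "homeomorphic_map X (subtopology S (i ` topspace X)) i"
    by (simp add: embedding_map_def)
  moreover have "i ` {x \<in> topspace X. i x \<in> C} = i ` topspace X \<inter> C" by blast
  moreover have "compactin S (i ` topspace X \<inter> C)"
    using closed_Int_compactin clopen_i(2) assms by blast
  ultimately show ?thesis
    using homeomorphic_map_compactness[of X "subtopology S (i ` topspace X)" i "{x \<in> topspace X. i x \<in> C}"]
    by (auto simp: compactin_subtopology)
qed

end

context open_decomposition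
begin

interpretation swapped: open_decomposition Y X S j i
  by (rule swap)

text \<open>
  A compact set \<open>C\<close> of \<open>S\<close> splits into a compact part in either copy, so the preimage of a subbasic set
  under gluing is a rectangle of subbasic sets.
\<close>

lemma continuous_glue:
  "continuous_map (prod_topology (compact_open X X) (compact_open Y Y))
    (subtopology (compact_open S S) split_maps) (\<lambda>(f, h). glue f h)"
proof -
  let ?P = "prod_topology (compact_open X X) (compact_open Y Y)"
  have "continuous_map ?P (compact_open S S) (\<lambda>(f, h). glue f h)"
  proof (rule continuous_map_into_compact_open)
    show "(case p of (f, h) \<Rightarrow> glue f h) \<in> cmaps S S" if "p \<in> topspace ?P" for p
      using that glue_in_split_maps by (auto simp: topspace_compact_open split_maps_def)
    fix C U assume C: "compactin S C" and U: "openin S U"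
    have CS: "C \<subseteq> topspace S" by (rule compactin_subset_topspace[OF C])
    let ?CX = "{x \<in> topspace X. i x \<in> C}" and ?CY = "{y \<in> topspace Y. j y \<in> C}"
    let ?UX = "{x \<in> topspace X. i x \<in> U}" and ?UY = "{y \<in> topspace Y. j y \<in> U}"
    have C_eq: "C = i ` ?CX \<union> j ` ?CY" using CS unfolding cover by auto
    have "glue f h ` C \<subseteq> U \<longleftrightarrow> f ` ?CX \<subseteq> ?UX \<and> h ` ?CY \<subseteq> ?UY"
      if "f \<in> cmaps X X" "h \<in> cmaps Y Y" for f h
    proof -
      have "f x \<in> topspace X" if "x \<in> topspace X" for x
        using that \<open>f \<in> cmaps X X\<close> by (auto simp: cmaps_def continuous_map)
      moreover have "h y \<in> topspace Y" if "y \<in> topspace Y" for y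
        using that \<open>h \<in> cmaps Y Y\<close> by (auto simp: cmaps_def continuous_map)
      moreover have "glue f h ` C = i ` f ` ?CX \<union> j ` h ` ?CY"
        by (subst C_eq) (auto simp: image_Un image_image glue_i glue_j cong: image_cong_simp)
      ultimately show ?thesis by auto
    qed
    then have "{p \<in> topspace ?P. (case p of (f, h) \<Rightarrow> glue f h) ` C \<subseteq> U}
        = {f \<in> cmaps X X. f ` ?CX \<subseteq> ?UX} \<times> {h \<in> cmaps Y Y. h ` ?CY \<subseteq> ?UY}"
      by (simp add: set_eq_iff topspace_compact_open conj_ac cong: conj_cong)
    moreover have "openin (compact_open X X) {f \<in> cmaps X X. f ` ?CX \<subseteq> ?UX}"
      by (intro openin_compact_open compactin_preimage_i C openin_continuous_map_preimage[OF cont_i U])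
    moreover have "openin (compact_open Y Y) {h \<in> cmaps Y Y. h ` ?CY \<subseteq> ?UY}"
      by (intro openin_compact_open swapped.compactin_preimage_i C
          openin_continuous_map_preimage[OF cont_j U])
    ultimately show "openin ?P {p \<in> topspace ?P. (case p of (f, h) \<Rightarrow> glue f h) ` C \<subseteq> U}"
      by (simp add: openin_prod_Times_iff)
  qed
  then show ?thesis
    using glue_in_split_maps
    by (auto simp: continuous_map_in_subtopology topspace_compact_open)
qed

lemma homeomorphic_split_maps:
  "homeomorphic_map (subtopology (compact_open S S) split_maps)
    (prod_topology (compact_open X X) (compact_open Y Y)) (\<lambda>g. (left_part g, right_part g))"
proof -
  have "homeomorphic_maps (subtopology (compact_open S S) split_maps)
    (prod_topology (compact_open X X) (compact_open Y Y)) (\<lambda>g. (left_part g, right_part g))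
    (\<lambda>(f, h). glue f h)"
    unfolding homeomorphic_maps_def
    by (auto simp: continuous_map_pairwise o_def continuous_left_part continuous_right_part
        continuous_glue glue_parts left_part_glue right_part_glue topspace_compact_open)
  then show ?thesis using homeomorphic_map_maps by blast
qed

text \<open>
  The conditions that single points stay in their copy, each of which is clopen. The whole mapping space
  is included so that the intersection is right even when \<open>X\<close> and \<open>Y\<close> are empty (the intersection of
  the empty family would be the whole type).
\<close>

definition evaluation_conditions :: "('s \<Rightarrow> 's) set set"
  where "evaluation_conditions = insert (cmaps S S)
    ((\<lambda>x. {g \<in> cmaps S S. g (i x) \<in> i ` topspace X}) ` topspace X \<union>
     (\<lambda>y. {g \<in> cmaps S S. g (j y) \<in> j ` topspace Y}) ` topspace Y)"

lemma Inter_evaluation_conditions: "\<Inter>evaluation_conditions = split_maps"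
  unfolding evaluation_conditions_def split_maps_def image_subset_iff by blast

lemma clopen_evaluation_conditions:
  assumes "T \<in> evaluation_conditions"
  shows "openin (compact_open S S) T \<and> closedin (compact_open S S) T"
proof -
  have *: "openin (compact_open S S) {g \<in> cmaps S S. g s \<in> W} \<and>
      closedin (compact_open S S) {g \<in> cmaps S S. g s \<in> W}"
    if "s \<in> topspace S" "openin S W" "closedin S W" for s W
    using that openin_continuous_map_preimage[OF continuous_map_evaluation, of s S S W]
      closedin_continuous_map_preimage[OF continuous_map_evaluation, of s S S W]
    by (simp add: topspace_compact_open)
  have "openin (compact_open S S) (cmaps S S) \<and> closedin (compact_open S S) (cmaps S S)"
    using openin_topspace[of "compact_open S S"] closedin_topspace[of "compact_open S S"]
    by (simp add: topspace_compact_open)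
  then show ?thesis
    using assms * clopen_i clopen_j cover by (auto simp: evaluation_conditions_def)
qed

end

section \<open>Maximal ideals and idempotents\<close>

lemma (in cring) Max_Spec_subset_Spec: "Max_Spec R \<subseteq> Spec R"
  using maximalideal_prime by (auto simp: Max_Spec_def Spec_def)

text \<open>
  Krull's theorem. The condition that \<open>\<one>\<close> be missing survives unions of chains, which makes Zorn's
  lemma applicable.
\<close>

lemma (in ring) proper_ideal_in_maximal:
  assumes I: "ideal I R" and proper: "\<one> \<notin> I"
  shows "\<exists>M \<in> Max_Spec R. I \<subseteq> M"
proof -
  define \<A> where "\<A> = {J. ideal J R \<and> I \<subseteq> J \<and> \<one> \<notin> J}"
  have "\<exists>M \<in> \<A>. \<forall>J \<in> \<A>. M \<subseteq> J \<longrightarrow> J = M"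
  proof (rule subset_Zorn_nonempty)
    show "\<A> \<noteq> {}" using I proper by (auto simp: \<A>_def)
    fix C assume C: "C \<noteq> {}" "subset.chain \<A> C"
    then have "subset.chain {J. ideal J R} C"
      unfolding \<A>_def pred_on.chain_def by blast
    then have "ideal (\<Union>C) R"
      using chain_Union_is_ideal[of C] C(1) by simp
    moreover have "C \<subseteq> \<A>" using C(2) by (simp add: pred_on.chain_def)
    ultimately show "\<Union>C \<in> \<A>" using C(1) unfolding \<A>_def by blast
  qed
  then obtain M where M: "M \<in> \<A>" "\<And>J. J \<in> \<A> \<Longrightarrow> M \<subseteq> J \<Longrightarrow> J = M" by blast
  have "maximalideal M R"
  proof (rule maximalidealI)
    show "ideal M R" "carrier R \<noteq> M" using M(1) by (auto simp: \<A>_def)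
    fix J assume J: "ideal J R" "M \<subseteq> J" "J \<subseteq> carrier R"
    show "J = M \<or> J = carrier R"
    proof (cases "\<one> \<in> J")
      case True
      then show ?thesis using ideal.one_imp_carrier[OF J(1)] by simp
    next
      case False
      then have "J \<in> \<A>" using J M(1) by (auto simp: \<A>_def)
      then show ?thesis using M(2) J(2) by simp
    qed
  qed
  then show ?thesis using M(1) by (auto simp: Max_Spec_def \<A>_def)
qed

text \<open>
  If \<open>e\<close> lies in every maximal ideal then \<open>\<one> \<ominus> e\<close> lies in none, hence is a unit; but
  \<open>(\<one> \<ominus> e) \<otimes> e = \<zero>\<close> for an idempotent \<open>e\<close>.
\<close>

lemma (in cring) idempotent_in_all_maximal_ideals:
  assumes e: "e \<in> carrier R" "e \<otimes> e = e" and all: "\<And>M. M \<in> Max_Spec R \<Longrightarrow> e \<in> M"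
  shows "e = \<zero>"
proof -
  have "\<one> \<in> PIdl (\<one> \<ominus> e)"
  proof (rule ccontr)
    assume "\<one> \<notin> PIdl (\<one> \<ominus> e)"
    then obtain M where M: "M \<in> Max_Spec R" "PIdl (\<one> \<ominus> e) \<subseteq> M"
      using proper_ideal_in_maximal[OF cgenideal_ideal] e by blast
    interpret maximalideal M R using M(1) by (simp add: Max_Spec_def)
    have "(\<one> \<ominus> e) \<oplus> e \<in> M"
      using M cgenideal_self[of "\<one> \<ominus> e"] all e by auto
    moreover have "(\<one> \<ominus> e) \<oplus> e = \<one>" using e by algebra
    ultimately show False using one_imp_carrier I_notcarr by auto
  qed
  then obtain x where x: "x \<in> carrier R" "\<one> = x \<otimes> (\<one> \<ominus> e)"
    unfolding cgenideal_def by blast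
  have "e = (x \<otimes> (\<one> \<ominus> e)) \<otimes> e" using x e by simp
  also have "\<dots> = x \<otimes> (e \<ominus> e \<otimes> e)" using x(1) e(1) by algebra
  also have "\<dots> = \<zero>" using x(1) e by algebra
  finally show ?thesis .
qed

lemma (in cring) openin_max_space:
  "openin (max_space R) U \<longleftrightarrow> (\<exists>T \<subseteq> carrier R. U = {M \<in> Max_Spec R. \<not> T \<subseteq> M})"
proof -
  have zariski: "openin (zariski R) = (\<lambda>V. \<exists>T \<subseteq> carrier R. V = Spec R - {P. T \<subseteq> P})"
    unfolding zariski_def by (rule topology_inverse'[OF istopology_zariski[OF is_cring]])
  have "(Spec R - {P. T \<subseteq> P}) \<inter> Max_Spec R = {M \<in> Max_Spec R. \<not> T \<subseteq> M}" for T
    using Max_Spec_subset_Spec by auto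
  then show ?thesis
    unfolding max_space_def openin_subtopology zariski by auto
qed

lemma (in cring) topspace_max_space: "topspace (max_space R) = Max_Spec R"
proof
  show "topspace (max_space R) \<subseteq> Max_Spec R" by (simp add: max_space_def)
  have "\<one> \<notin> M" if "M \<in> Max_Spec R" for M
  proof -
    interpret maximalideal M R using that by (simp add: Max_Spec_def)
    show ?thesis using one_imp_carrier I_notcarr by auto
  qed
  \<comment> \<open>The basic open set of \<open>{\<one>}\<close> is the whole space.\<close>
  then have "openin (max_space R) (Max_Spec R)"
    unfolding openin_max_space by (intro exI[of _ "{\<one>}"]) auto
  then show "Max_Spec R \<subseteq> topspace (max_space R)" by (rule openin_subset)
qed

lemma (in pm_ring) retr_Spec:
  assumes "P \<in> Spec R"
  shows "retr R P \<in> Max_Spec R" and "P \<subseteq> retr R P"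
  using theI'[OF unique_maximal[OF assms]] by (auto simp: retr_def)

lemma (in pm_ring) retr_eqI:
  assumes "P \<in> Spec R" and "M \<in> Max_Spec R" and "P \<subseteq> M"
  shows "retr R P = M"
  using unique_maximal[OF assms(1)] retr_Spec[OF assms(1)] assms(2,3) by auto

lemma (in pm_ring) retr_Max_Spec: "M \<in> Max_Spec R \<Longrightarrow> retr R M = M"
  using retr_eqI Max_Spec_subset_Spec by blast

definition comap :: "('a, 'm) ring_scheme \<Rightarrow> ('a \<Rightarrow> 'b) \<Rightarrow> 'b set \<Rightarrow> 'a set"
  where "comap R h P = {r \<in> carrier R. h r \<in> P}"

lemma (in ring_hom_cring) comap_Spec: "P \<in> Spec S \<Longrightarrow> comap R h P \<in> Spec R"
  using ring.primeideal_vimage[OF R.is_cring] by (simp add: Spec_def comap_def)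

text \<open>
  The projection of a product ring onto one of its factors, described without reference to the other
  factor: \<open>h\<close> is surjective and \<open>u\<close> is the idempotent of that factor, so that \<open>S\<close> is isomorphic to the
  part of \<open>R\<close> cut out by \<open>u\<close>. Both projections of \<open>A \<times> B\<close> are instances, and everything below is
  proved once for the two of them.
\<close>

locale ring_factor = ring_hom_cring R S h for R (structure) and S (structure) and h +
  fixes u
  assumes surj: "h ` carrier R = carrier S"
    and u: "u \<in> carrier R" "h u = \<one>\<^bsub>S\<^esub>"
    and annihilates: "\<And>r. r \<in> carrier R \<Longrightarrow> h r = \<zero>\<^bsub>S\<^esub> \<Longrightarrow> u \<otimes> r = \<zero>"
begin

text \<open>The idempotent of the other factor; it generates the kernel of \<open>h\<close>.\<close>

definition v where "v = \<one> \<ominus> u"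

lemma v: "v \<in> carrier R" "h v = \<zero>\<^bsub>S\<^esub>" "u \<otimes> v = \<zero>" "u \<oplus> v = \<one>"
proof -
  show v: "v \<in> carrier R" using u by (simp add: v_def)
  show hv: "h v = \<zero>\<^bsub>S\<^esub>"
    using u by (simp add: v_def R.minus_eq S.r_neg)
  show "u \<otimes> v = \<zero>" using annihilates[OF v hv] .
  show "u \<oplus> v = \<one>" unfolding v_def using u(1) by algebra
qed

lemma v_absorbs:
  assumes "r \<in> carrier R" "h r = \<zero>\<^bsub>S\<^esub>"
  shows "v \<otimes> r = r"
proof -
  have "r = (u \<oplus> v) \<otimes> r" using assms v by simp
  also have "\<dots> = u \<otimes> r \<oplus> v \<otimes> r" by (rule R.l_distr) (use assms u v in simp_all)
  also have "\<dots> = v \<otimes> r" using assms v annihilates by simp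
  finally show ?thesis ..
qed

lemma image_comap:
  assumes "P \<subseteq> carrier S"
  shows "h ` comap R h P = P"
proof -
  have "h ` comap R h P = h ` carrier R \<inter> P" by (auto simp: comap_def)
  then show ?thesis using assms unfolding surj by blast
qed

text \<open>
  Together with \<open>image_comap\<close> this is the correspondence between the ideals of \<open>S\<close> and the ideals
  of \<open>R\<close> that contain the kernel of \<open>h\<close>. Since \<open>v\<close> generates the kernel, containing it amounts to
  containing \<open>v\<close>.
\<close>

lemma comap_image:
  assumes J: "ideal J R" and vJ: "v \<in> J"
  shows "comap R h (h ` J) = J"
proof
  interpret ideal J R by fact
  show "J \<subseteq> comap R h (h ` J)" by (auto simp: comap_def)
  show "comap R h (h ` J) \<subseteq> J"
  proof
    fix r assume "r \<in> comap R h (h ` J)"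
    then obtain s where r: "r \<in> carrier R" and s: "s \<in> J" "h r = h s"
      by (auto simp: comap_def)
    have sR: "s \<in> carrier R" using s by simp
    have "h (r \<ominus> s) = \<zero>\<^bsub>S\<^esub>" using r s sR by (simp add: R.minus_eq S.r_neg)
    then have "r \<ominus> s = v \<otimes> (r \<ominus> s)" using v_absorbs r sR by simp
    also have "\<dots> \<in> J" using I_r_closed[OF vJ] r sR by simp
    finally have "(r \<ominus> s) \<oplus> s \<in> J" using s by simp
    moreover have "(r \<ominus> s) \<oplus> s = r" using r sR by algebra
    ultimately show "r \<in> J" by simp
  qed
qed

lemma v_in_comap: "ideal P S \<Longrightarrow> v \<in> comap R h P"
  using v by (simp add: comap_def additive_subgroup.zero_closed ideal.axioms(1))

lemma ideal_comap: "ideal P S \<Longrightarrow> ideal (comap R h P) R"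
  using ring.ideal_vimage by (simp add: comap_def)

lemma ideal_image:
  assumes "ideal J R"
  shows "ideal (h ` J) S"
proof (rule idealI)
  interpret ideal J R by fact
  show "ring S" by (rule S.ring_axioms)
  show "subgroup (h ` J) (add_monoid S)"
    by (rule ring.img_is_add_subgroup[OF a_subgroup])
  fix a x assume "a \<in> h ` J" "x \<in> carrier S"
  then obtain b y where b: "b \<in> J" "a = h b" and y: "y \<in> carrier R" "x = h y"
    using surj by blast
  then have "x \<otimes>\<^bsub>S\<^esub> a = h (y \<otimes> b)" "a \<otimes>\<^bsub>S\<^esub> x = h (b \<otimes> y)" by simp_all
  then show "x \<otimes>\<^bsub>S\<^esub> a \<in> h ` J" "a \<otimes>\<^bsub>S\<^esub> x \<in> h ` J"
    using I_l_closed[OF b(1) y(1)] I_r_closed[OF b(1) y(1)] by (simp_all only: image_eqI)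
qed

lemma comap_subset_iff:
  assumes "P \<subseteq> carrier S" "Q \<subseteq> carrier S"
  shows "comap R h P \<subseteq> comap R h Q \<longleftrightarrow> P \<subseteq> Q"
proof
  assume "comap R h P \<subseteq> comap R h Q"
  then have "h ` comap R h P \<subseteq> h ` comap R h Q" by blast
  then show "P \<subseteq> Q" using assms by (simp add: image_comap)
qed (auto simp: comap_def)

lemma comap_carrier: "comap R h (carrier S) = carrier R"
  by (auto simp: comap_def)

lemma comap_Max_Spec:
  assumes "M \<in> Max_Spec S"
  shows "comap R h M \<in> Max_Spec R"
proof -
  interpret M: maximalideal M S using assms by (simp add: Max_Spec_def)
  have MS: "M \<subseteq> carrier S" by (rule M.a_subset)
  have "maximalideal (comap R h M) R"
  proof (rule maximalidealI)
    show "ideal (comap R h M) R" by (rule ideal_comap[OF M.is_ideal])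
    show "carrier R \<noteq> comap R h M"
      using MS image_comap[OF MS] surj M.I_notcarr by force
    fix J assume J: "ideal J R" "comap R h M \<subseteq> J" "J \<subseteq> carrier R"
    have "v \<in> J" using v_in_comap[OF M.is_ideal] J(2) by blast
    note eq = comap_image[OF J(1) this]
    have "ideal (h ` J) S" "M \<subseteq> h ` J" "h ` J \<subseteq> carrier S"
      using ideal_image[OF J(1)] image_mono[OF J(2), of h] image_comap[OF MS] J(3) by auto
    then have "h ` J = M \<or> h ` J = carrier S" by (rule M.I_maximal)
    then show "J = comap R h M \<or> J = carrier R" using eq comap_carrier by auto
  qed
  then show ?thesis by (simp add: Max_Spec_def)
qed

text \<open>
  The product of the two idempotents is \<open>\<zero>\<close> and their sum is \<open>\<one>\<close>. This is what sorts the prime ideals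
  of a product into those coming from either factor.
\<close>

lemma u_or_v_in_prime:
  assumes "P \<in> Spec R"
  shows "u \<in> P \<longleftrightarrow> v \<notin> P"
proof -
  interpret primeideal P R using assms by (simp add: Spec_def)
  have "u \<in> P \<or> v \<in> P" using I_prime[OF u(1) v(1)] v(3) by simp
  moreover have "\<not> (u \<in> P \<and> v \<in> P)"
    using a_closed[of u v] v(4) one_imp_carrier I_notcarr by auto
  ultimately show ?thesis by blast
qed

lemma image_Max_Spec:
  assumes M: "M \<in> Max_Spec R" and uM: "u \<notin> M"
  shows "h ` M \<in> Max_Spec S" and "comap R h (h ` M) = M"
proof -
  interpret M: maximalideal M R using M by (simp add: Max_Spec_def)
  have "v \<in> M" using u_or_v_in_prime R.Max_Spec_subset_Spec M uM by blast
  then show eq: "comap R h (h ` M) = M" by (rule comap_image[OF M.is_ideal])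
  have "maximalideal (h ` M) S"
  proof (rule maximalidealI)
    show "ideal (h ` M) S" by (rule ideal_image[OF M.is_ideal])
    show "carrier S \<noteq> h ` M" using eq comap_carrier M.I_notcarr by auto
    fix J assume J: "ideal J S" "h ` M \<subseteq> J" "J \<subseteq> carrier S"
    have "M \<subseteq> comap R h J" using J(2) M.a_subset by (auto simp: comap_def)
    then have "comap R h J = M \<or> comap R h J = carrier R"
      using M.I_maximal[OF ideal_comap[OF J(1)]] by (auto simp: comap_def)
    then show "J = h ` M \<or> J = carrier S" using image_comap[OF J(3)] surj by auto
  qed
  then show "h ` M \<in> Max_Spec S" by (simp add: Max_Spec_def)
qed

lemma image_Spec:
  assumes P: "P \<in> Spec R" and uP: "u \<notin> P"
  shows "h ` P \<in> Spec S" and "comap R h (h ` P) = P"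
proof -
  interpret P: primeideal P R using P by (simp add: Spec_def)
  have "v \<in> P" using u_or_v_in_prime P uP by blast
  then show eq: "comap R h (h ` P) = P" by (rule comap_image[OF P.is_ideal])
  have "primeideal (h ` P) S"
  proof (rule primeidealI)
    show "ideal (h ` P) S" by (rule ideal_image[OF P.is_ideal])
    show "cring S" by (rule S.is_cring)
    show "carrier S \<noteq> h ` P" using eq comap_carrier P.I_notcarr by auto
    fix a b assume ab: "a \<in> carrier S" "b \<in> carrier S" "a \<otimes>\<^bsub>S\<^esub> b \<in> h ` P"
    then obtain x y where x: "x \<in> carrier R" "a = h x" and y: "y \<in> carrier R" "b = h y"
      using surj by blast
    have "x \<otimes> y \<in> comap R h (h ` P)" using ab(3) x y by (simp add: comap_def)
    then have "x \<in> P \<or> y \<in> P" using eq P.I_prime x y by simp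
    then show "a \<in> h ` P \<or> b \<in> h ` P" using x y by auto
  qed
  then show "h ` P \<in> Spec S" by (simp add: Spec_def)
qed

lemma u_notin_comap:
  assumes "P \<in> Spec S"
  shows "u \<notin> comap R h P"
proof -
  have "ideal P S" using assms by (simp add: Spec_def primeideal_def)
  then show ?thesis
    using v_in_comap u_or_v_in_prime comap_Spec[OF assms] by blast
qed

lemma comap_image_Max_Spec: "comap R h ` Max_Spec S = {M \<in> Max_Spec R. u \<notin> M}"
proof (intro equalityI subsetI)
  fix N assume "N \<in> comap R h ` Max_Spec S"
  then obtain M where M: "M \<in> Max_Spec S" "N = comap R h M" by blast
  have "M \<in> Spec S" using M(1) S.Max_Spec_subset_Spec by (rule rev_subsetD)
  then show "N \<in> {M \<in> Max_Spec R. u \<notin> M}"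
    unfolding M(2) using comap_Max_Spec[OF M(1)] u_notin_comap by simp
next
  fix N assume "N \<in> {M \<in> Max_Spec R. u \<notin> M}"
  then show "N \<in> comap R h ` Max_Spec S"
    using image_Max_Spec[of N] by (metis image_eqI mem_Collect_eq)
qed

text \<open>
  A maximal ideal above a prime that comes from \<open>S\<close> contains \<open>v\<close> as well, so it comes from \<open>S\<close> too, and
  there the pm-property decides.
\<close>

lemma unique_maximal_comap:
  assumes S: "pm_ring S" and P: "P \<in> Spec S"
    and M: "M \<in> Max_Spec R" "comap R h P \<subseteq> M"
  shows "M = comap R h (retr S P)"
proof -
  interpret S': pm_ring S by fact
  have "v \<in> M" using v_in_comap[of P] P M(2) by (auto simp: Spec_def primeideal_def)
  then have uM: "u \<notin> M" using u_or_v_in_prime R.Max_Spec_subset_Spec M(1) by blast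
  note N = image_Max_Spec[OF M(1) uM]
  have "P \<subseteq> carrier S"
    using P by (simp add: Spec_def primeideal_def ideal_def additive_subgroup.a_subset)
  then have "P \<subseteq> h ` M" using image_mono[OF M(2), of h] image_comap by simp
  then have "retr S P = h ` M" using S'.retr_eqI[OF P N(1)] by simp
  then show ?thesis using N(2) by simp
qed

lemma unique_maximal_if_u_notin:
  assumes S: "pm_ring S" and P: "P \<in> Spec R" and uP: "u \<notin> P"
  shows "\<exists>!M. M \<in> Max_Spec R \<and> P \<subseteq> M"
proof -
  interpret S': pm_ring S by fact
  note Q = image_Spec[OF P uP]
  have "comap R h (h ` P) \<subseteq> comap R h (retr S (h ` P))"
    using S'.retr_Spec(2)[OF Q(1)] by (auto simp: comap_def)
  then show ?thesis
    using comap_Max_Spec[OF S'.retr_Spec(1)[OF Q(1)]] unique_maximal_comap[OF S Q(1)] Q(2)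
    by (metis (no_types, lifting))
qed

lemma retr_comap:
  assumes R: "pm_ring R" and S: "pm_ring S" and P: "P \<in> Spec S"
  shows "retr R (comap R h P) = comap R h (retr S P)"
  using unique_maximal_comap[OF S P] pm_ring.retr_Spec[OF R comap_Spec[OF P]] by blast

text \<open>
  If \<open>f\<close> covers \<open>g\<close> along \<open>h\<close>, then the spectral map of \<open>f\<close> extends that of \<open>g\<close> on the copy of
  \<open>Max S\<close>: both preimages and retractions commute with pulling back along \<open>h\<close>.
\<close>

lemma spectral_map_comap:
  assumes R: "pm_ring R" and S: "pm_ring S"
    and g: "g \<in> ring_hom S S"
    and fg: "\<And>r. r \<in> carrier R \<Longrightarrow> f r \<in> carrier R \<and> h (f r) = g (h r)"
    and M: "M \<in> Max_Spec S"
  shows "spectral_map R f (comap R h M) = comap R h (spectral_map S g M)"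
proof -
  have g': "ring_hom_cring S S g"
    by (rule ring_hom_cring.intro[OF S.is_cring S.is_cring ring_hom_cring_axioms.intro[OF g]])
  have "f -` comap R h M \<inter> carrier R = comap R h (g -` M \<inter> carrier S)"
  proof (rule Set.set_eqI)
    show "r \<in> f -` comap R h M \<inter> carrier R \<longleftrightarrow> r \<in> comap R h (g -` M \<inter> carrier S)" for r
      by (cases "r \<in> carrier R") (simp_all add: comap_def fg)
  qed
  moreover have "g -` M \<inter> carrier S = comap S g M" by (auto simp: comap_def)
  moreover have "comap S g M \<in> Spec S" using ring_hom_cring.comap_Spec[OF g'] M S.Max_Spec_subset_Spec by blast
  ultimately show ?thesis
    using M comap_Max_Spec[OF M] retr_comap[OF R S] by (simp add: spectral_map_def)
qed

text \<open>
  The converse direction: the spectral map alone forces \<open>f\<close> to descend to \<open>S\<close>. If a maximal ideal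
  \<open>N\<close> of the copy of \<open>Max S\<close> is sent into that copy, the prime \<open>f -` N\<close> lies in a maximal ideal without
  \<open>u\<close>, so it omits \<open>u\<close> and contains \<open>v\<close>. As this holds for all such \<open>N\<close>, the idempotent \<open>h (f v)\<close> lies in every
  maximal ideal of \<open>S\<close> and vanishes, and \<open>v\<close> generates the kernel.
\<close>

lemma preserves_kernel:
  assumes R: "pm_ring R" and f: "f \<in> ring_hom R R"
    and preserves: "\<And>M. M \<in> Max_Spec R \<Longrightarrow> u \<notin> M \<Longrightarrow> u \<notin> spectral_map R f M"
    and r: "r \<in> carrier R" "h r = \<zero>\<^bsub>S\<^esub>"
  shows "h (f r) = \<zero>\<^bsub>S\<^esub>"
proof -
  have f': "ring_hom_cring R R f"
    by (rule ring_hom_cring.intro[OF R.is_cring R.is_cring ring_hom_cring_axioms.intro[OF f]])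
  note f_simps [simp] = ring_hom_closed[OF f] ring_hom_mult[OF f]
  have "h (f v) \<in> M" if M: "M \<in> Max_Spec S" for M
  proof -
    let ?N = "comap R h M"
    have N: "?N \<in> Max_Spec R" "u \<notin> ?N"
      using M comap_image_Max_Spec by auto
    have "f -` ?N \<inter> carrier R = comap R f ?N" by (auto simp: comap_def)
    moreover have prime: "comap R f ?N \<in> Spec R"
      using ring_hom_cring.comap_Spec[OF f'] N R.Max_Spec_subset_Spec by blast
    ultimately have "comap R f ?N \<subseteq> spectral_map R f ?N"
      using pm_ring.retr_Spec(2)[OF R] N by (simp add: spectral_map_def)
    then have "u \<notin> comap R f ?N" using preserves[OF N] by blast
    then have "v \<in> comap R f ?N" using u_or_v_in_prime[OF prime] by blast
    then show ?thesis by (simp add: comap_def)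
  qed
  moreover have "h (f v) \<otimes>\<^bsub>S\<^esub> h (f v) = h (f v)"
  proof -
    have "h (f v) \<otimes>\<^bsub>S\<^esub> h (f v) = h (f (v \<otimes> v))" using v(1) by simp
    then show ?thesis using v_absorbs[OF v(1,2)] by simp
  qed
  ultimately have hfv: "h (f v) = \<zero>\<^bsub>S\<^esub>"
    using S.idempotent_in_all_maximal_ideals v(1) by simp
  have "h (f r) = h (f (v \<otimes> r))" using v_absorbs[OF r] by simp
  then show ?thesis using hfv v(1) r(1) by simp
qed

lemma induced_endomorphism:
  assumes f: "f \<in> ring_hom R R"
    and ker: "\<And>r. r \<in> carrier R \<Longrightarrow> h r = \<zero>\<^bsub>S\<^esub> \<Longrightarrow> h (f r) = \<zero>\<^bsub>S\<^esub>"
  obtains g where "g \<in> ring_hom S S" "g \<in> extensional (carrier S)"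
    "\<And>r. r \<in> carrier R \<Longrightarrow> h (f r) = g (h r)"
proof
  note f_simps [simp] = ring_hom_closed[OF f] ring_hom_mult[OF f] ring_hom_add[OF f] ring_hom_one[OF f]
  define g where "g = (\<lambda>s \<in> carrier S. h (f (inv_into (carrier R) h s)))"
  show "g \<in> extensional (carrier S)" by (simp add: g_def)
  show g: "h (f r) = g (h r)" if r: "r \<in> carrier R" for r
  proof -
    define t where "t = inv_into (carrier R) h (h r)"
    have t: "t \<in> carrier R" "h t = h r"
      using r by (simp_all add: t_def inv_into_into f_inv_into_f)
    have "h (r \<ominus> t) = \<zero>\<^bsub>S\<^esub>" using r t by (simp add: R.minus_eq S.r_neg)
    then have "h (f (r \<ominus> t)) = \<zero>\<^bsub>S\<^esub>" using ker r t(1) by simp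
    moreover have "h (f r) = h (f (r \<ominus> t)) \<oplus>\<^bsub>S\<^esub> h (f t)"
    proof -
      have "r = (r \<ominus> t) \<oplus> t" using r t(1) by algebra
      then have "h (f r) = h (f ((r \<ominus> t) \<oplus> t))" by (rule arg_cong)
      then show ?thesis using r t(1) by simp
    qed
    ultimately have "h (f r) = h (f t)" using t(1) by simp
    then show ?thesis using r by (simp add: g_def t_def)
  qed
  show "g \<in> ring_hom S S"
  proof (rule ring_hom_memI)
    fix x y assume "x \<in> carrier S" "y \<in> carrier S"
    then obtain a b where a: "a \<in> carrier R" "x = h a" and b: "b \<in> carrier R" "y = h b"
      using surj by blast
    have "g x = h (f a)" "g y = h (f b)" "g (x \<otimes>\<^bsub>S\<^esub> y) = h (f (a \<otimes> b))"
      "g (x \<oplus>\<^bsub>S\<^esub> y) = h (f (a \<oplus> b))"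
      using a b g[of a] g[of b] g[of "a \<otimes> b"] g[of "a \<oplus> b"] by simp_all
    then show "g x \<in> carrier S" "g (x \<otimes>\<^bsub>S\<^esub> y) = g x \<otimes>\<^bsub>S\<^esub> g y"
      "g (x \<oplus>\<^bsub>S\<^esub> y) = g x \<oplus>\<^bsub>S\<^esub> g y"
      using a(1) b(1) by simp_all
  next
    show "g \<one>\<^bsub>S\<^esub> = \<one>\<^bsub>S\<^esub>" using g[of \<one>] by simp
  qed
qed

lemma continuous_map_comap: "continuous_map (max_space S) (max_space R) (comap R h)"
  unfolding continuous_map R.topspace_max_space S.topspace_max_space
proof (intro conjI allI impI)
  show "comap R h ` Max_Spec S \<subseteq> Max_Spec R" unfolding comap_image_Max_Spec by simp
  fix U assume "openin (max_space R) U"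
  then obtain T where T: "T \<subseteq> carrier R" "U = {M \<in> Max_Spec R. \<not> T \<subseteq> M}"
    unfolding R.openin_max_space by blast
  have "T \<subseteq> comap R h M \<longleftrightarrow> h ` T \<subseteq> M" for M
    using T(1) unfolding comap_def by blast
  then have "{M \<in> Max_Spec S. comap R h M \<in> U} = {M \<in> Max_Spec S. \<not> h ` T \<subseteq> M}"
    unfolding T(2) by (simp add: comap_Max_Spec cong: conj_cong)
  moreover have "h ` T \<subseteq> carrier S" using T(1) surj by blast
  ultimately show "openin (max_space S) {M \<in> Max_Spec S. comap R h M \<in> U}"
    unfolding S.openin_max_space by (intro exI[of _ "h ` T"] conjI)
qed

lemma inj_on_comap: "inj_on (comap R h) (Max_Spec S)"
proof (rule inj_on_inverseI)
  fix M assume "M \<in> Max_Spec S"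
  then show "h ` comap R h M = M"
    by (intro image_comap) (simp add: Max_Spec_def maximalideal_def ideal_def additive_subgroup.a_subset)
qed

text \<open>
  The image of \<open>Max S\<close> is the basic open set of maximal ideals avoiding \<open>u\<close>; within it, containing \<open>T\<close>
  downstairs means containing the preimage of \<open>T\<close> upstairs.
\<close>

lemma open_map_comap: "open_map (max_space S) (max_space R) (comap R h)"
  unfolding open_map_def
proof (intro allI impI)
  fix U assume "openin (max_space S) U"
  then obtain T where T: "T \<subseteq> carrier S" "U = {M \<in> Max_Spec S. \<not> T \<subseteq> M}"
    unfolding S.openin_max_space by blast
  have "T \<subseteq> M \<longleftrightarrow> comap R h T \<subseteq> comap R h M" if "M \<in> Max_Spec S" for M
    using comap_subset_iff[OF T(1), of M] that
    by (simp add: Max_Spec_def maximalideal_def ideal_def additive_subgroup.a_subset)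
  then have "comap R h ` U = comap R h ` Max_Spec S \<inter> {M \<in> Max_Spec R. \<not> comap R h T \<subseteq> M}"
    unfolding T(2) using comap_Max_Spec by blast
  moreover have "openin (max_space R) {M \<in> Max_Spec R. \<not> comap R h T \<subseteq> M}"
    unfolding R.openin_max_space by (rule exI[of _ "comap R h T"]) (auto simp: comap_def)
  moreover have "openin (max_space R) (comap R h ` Max_Spec S)"
    unfolding R.openin_max_space comap_image_Max_Spec by (rule exI[of _ "{u}"]) (use u in auto)
  ultimately show "openin (max_space R) (comap R h ` U)" by auto
qed

end

section \<open>Products of pm-algebras\<close>

lemma alg_prod_simps [simp]:
  "carrier (alg_prod A B) = carrier A \<times> carrier B"
  "x \<otimes>\<^bsub>alg_prod A B\<^esub> y = (fst x \<otimes>\<^bsub>A\<^esub> fst y, snd x \<otimes>\<^bsub>B\<^esub> snd y)"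
  "x \<oplus>\<^bsub>alg_prod A B\<^esub> y = (fst x \<oplus>\<^bsub>A\<^esub> fst y, snd x \<oplus>\<^bsub>B\<^esub> snd y)"
  "\<one>\<^bsub>alg_prod A B\<^esub> = (\<one>\<^bsub>A\<^esub>, \<one>\<^bsub>B\<^esub>)"
  "\<zero>\<^bsub>alg_prod A B\<^esub> = (\<zero>\<^bsub>A\<^esub>, \<zero>\<^bsub>B\<^esub>)"
  "r \<odot>\<^bsub>alg_prod A B\<^esub> x = (r \<odot>\<^bsub>A\<^esub> fst x, r \<odot>\<^bsub>B\<^esub> snd x)"
  by (cases x; cases y; simp add: alg_prod_def RDirProd_def DirProd_def ring.defs monoid.defs)+

lemma cring_alg_prod:
  assumes "cring A" and "cring B"
  shows "cring (alg_prod A B)"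
proof -
  interpret A: cring A by fact
  interpret B: cring B by fact
  show ?thesis
  proof (rule cringI)
    show "abelian_group (alg_prod A B)"
    proof (rule abelian_groupI)
      fix x assume "x \<in> carrier (alg_prod A B)"
      then show "\<exists>y \<in> carrier (alg_prod A B). y \<oplus>\<^bsub>alg_prod A B\<^esub> x = \<zero>\<^bsub>alg_prod A B\<^esub>"
        by (intro bexI[of _ "(\<ominus>\<^bsub>A\<^esub> fst x, \<ominus>\<^bsub>B\<^esub> snd x)"]) (auto simp: A.l_neg B.l_neg)
    qed (auto simp: A.a_ac B.a_ac)
    show "Group.comm_monoid (alg_prod A B)"
      by (rule comm_monoidI) (auto simp: A.m_ac B.m_ac)
  qed (auto simp: A.l_distr B.l_distr)
qed

lemma ring_factor_fst:
  assumes "cring A" and "cring B"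
  shows "ring_factor (alg_prod A B) A fst (\<one>\<^bsub>A\<^esub>, \<zero>\<^bsub>B\<^esub>)"
proof -
  interpret A: cring A by fact
  interpret B: cring B by fact
  have "ring_hom_cring (alg_prod A B) A fst"
    by (intro ring_hom_cring.intro ring_hom_cring_axioms.intro cring_alg_prod assms)
      (auto simp: ring_hom_def)
  then show ?thesis
    by (rule ring_factor.intro) (unfold_locales, auto)
qed

lemma ring_factor_snd:
  assumes "cring A" and "cring B"
  shows "ring_factor (alg_prod A B) B snd (\<zero>\<^bsub>A\<^esub>, \<one>\<^bsub>B\<^esub>)"
proof -
  interpret A: cring A by fact
  interpret B: cring B by fact
  have "ring_hom_cring (alg_prod A B) B snd"
    by (intro ring_hom_cring.intro ring_hom_cring_axioms.intro cring_alg_prod assms)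
      (auto simp: ring_hom_def)
  then show ?thesis
    by (rule ring_factor.intro) (unfold_locales, auto)
qed

lemma alg_EndD:
  assumes "f \<in> alg_End K A"
  shows "f \<in> ring_hom A A" "f \<in> extensional (carrier A)"
    "\<And>r a. r \<in> carrier K \<Longrightarrow> a \<in> carrier A \<Longrightarrow> f (r \<odot>\<^bsub>A\<^esub> a) = r \<odot>\<^bsub>A\<^esub> f a"
  using assms by (auto simp: alg_End_def)

lemma induced_alg_End:
  fixes R :: "('k, 'a) module" and S :: "('k, 'b) module"
  assumes factor: "ring_factor R S h u" and f: "f \<in> alg_End K R"
    and smult: "\<And>r a. r \<in> carrier K \<Longrightarrow> a \<in> carrier R \<Longrightarrow> r \<odot>\<^bsub>R\<^esub> a \<in> carrier R"
    and linear: "\<And>r a. r \<in> carrier K \<Longrightarrow> a \<in> carrier R \<Longrightarrow> h (r \<odot>\<^bsub>R\<^esub> a) = r \<odot>\<^bsub>S\<^esub> h a"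
    and ker: "\<And>r. r \<in> carrier R \<Longrightarrow> h r = \<zero>\<^bsub>S\<^esub> \<Longrightarrow> h (f r) = \<zero>\<^bsub>S\<^esub>"
  obtains g where "g \<in> alg_End K S" "\<And>r. r \<in> carrier R \<Longrightarrow> h (f r) = g (h r)"
proof -
  interpret ring_factor R S h u by fact
  note fD = alg_EndD[OF f]
  obtain g where g: "g \<in> ring_hom S S" "g \<in> extensional (carrier S)"
    and gh: "\<And>r. r \<in> carrier R \<Longrightarrow> h (f r) = g (h r)"
    using induced_endomorphism[OF fD(1) ker] by blast
  have "g (r \<odot>\<^bsub>S\<^esub> s) = r \<odot>\<^bsub>S\<^esub> g s" if r: "r \<in> carrier K" and s: "s \<in> carrier S" for r s
  proof -
    obtain a where a: "a \<in> carrier R" "s = h a" using s surj by blast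
    have "g (r \<odot>\<^bsub>S\<^esub> s) = h (f (r \<odot>\<^bsub>R\<^esub> a))"
      using gh[OF smult[OF r a(1)]] linear[OF r a(1)] a(2) by simp
    also have "\<dots> = r \<odot>\<^bsub>S\<^esub> h (f a)"
      using fD(3)[OF r a(1)] linear[OF r ring_hom_closed[OF fD(1) a(1)]] by simp
    finally show ?thesis using gh[OF a(1)] a(2) by simp
  qed
  then have "g \<in> alg_End K S" using g by (simp add: alg_End_def)
  then show ?thesis using that gh by blast
qed

lemma (in pm_ring) spectral_map_in_Max_Spec:
  assumes f: "f \<in> ring_hom R R" and M: "M \<in> Max_Spec R"
  shows "spectral_map R f M \<in> Max_Spec R"
proof -
  have f': "ring_hom_cring R R f"
    by (rule ring_hom_cring.intro[OF is_cring is_cring ring_hom_cring_axioms.intro[OF f]])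
  have "f -` M \<inter> carrier R = comap R f M" by (auto simp: comap_def)
  moreover have "comap R f M \<in> Spec R"
    using ring_hom_cring.comap_Spec[OF f'] M Max_Spec_subset_Spec by blast
  ultimately show ?thesis
    using M retr_Spec(1) by (simp add: spectral_map_def)
qed

lemma id_alg_End:
  assumes "Module.algebra K R"
  shows "(\<lambda>a \<in> carrier R. a) \<in> alg_End K R"
proof -
  interpret Module.algebra K R by fact
  show ?thesis
    by (auto simp: alg_End_def ring_hom_def)
qed

lemma (in pm_ring) spectral_map_id:
  "spectral_map R (\<lambda>a \<in> carrier R. a) = (\<lambda>M \<in> Max_Spec R. M)"
proof -
  have "(\<lambda>a \<in> carrier R. a) -` M \<inter> carrier R = M" if "M \<in> Max_Spec R" for M
    using that by (auto simp: Max_Spec_def dest: additive_subgroup.a_Hcarr[OF ideal.axioms(1)[OF maximalideal.axioms(1)]])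
  then show ?thesis
    unfolding spectral_map_def by (intro restrict_ext) (simp add: retr_Max_Spec)
qed

lemma spectral_map_extensional:
  "spectral_map R f \<in> extensional (Max_Spec R)"
  by (simp add: spectral_map_def)

locale pm_algebra_product =
  fixes K :: "('k, 'l) ring_scheme" and A :: "('k, 'a) module" and B :: "('k, 'b) module"
  assumes algebra_A: "Module.algebra K A" and pm_A: "pm_ring A"
    and algebra_B: "Module.algebra K B" and pm_B: "pm_ring B"
begin

abbreviation P where "P \<equiv> alg_prod A B"

sublocale A: pm_ring A by (rule pm_A)
sublocale B: pm_ring B by (rule pm_B)
sublocale P: cring P by (rule cring_alg_prod[OF A.is_cring B.is_cring])
sublocale left: ring_factor P A fst "(\<one>\<^bsub>A\<^esub>, \<zero>\<^bsub>B\<^esub>)"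
  by (rule ring_factor_fst[OF A.is_cring B.is_cring])
sublocale right: ring_factor P B snd "(\<zero>\<^bsub>A\<^esub>, \<one>\<^bsub>B\<^esub>)"
  by (rule ring_factor_snd[OF A.is_cring B.is_cring])

text \<open>
  The complementary idempotent of the first factor is the idempotent of the second, so every prime omits
  exactly one of the two and comes from exactly one factor.
\<close>

lemma one_idempotent_in_prime:
  assumes "Q \<in> Spec P"
  shows "(\<one>\<^bsub>A\<^esub>, \<zero>\<^bsub>B\<^esub>) \<in> Q \<longleftrightarrow> (\<zero>\<^bsub>A\<^esub>, \<one>\<^bsub>B\<^esub>) \<notin> Q"
proof -
  have "left.v = (\<zero>\<^bsub>A\<^esub>, \<one>\<^bsub>B\<^esub>)"
  proof -
    have "left.v \<in> carrier P" "fst left.v = \<zero>\<^bsub>A\<^esub>"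
      and "(\<one>\<^bsub>A\<^esub>, \<zero>\<^bsub>B\<^esub>) \<oplus>\<^bsub>P\<^esub> left.v = \<one>\<^bsub>P\<^esub>"
      using left.v by simp_all
    then show ?thesis by (cases left.v) auto
  qed
  then show ?thesis using left.u_or_v_in_prime[OF assms] by simp
qed

lemma pm_P: "pm_ring P"
proof (intro pm_ring.intro pm_ring_axioms.intro)
  show "cring P" by (rule P.is_cring)
  show "\<exists>!M. M \<in> Max_Spec P \<and> Q \<subseteq> M" if "Q \<in> Spec P" for Q
  proof (cases "(\<one>\<^bsub>A\<^esub>, \<zero>\<^bsub>B\<^esub>) \<in> Q")
    case True
    then have "(\<zero>\<^bsub>A\<^esub>, \<one>\<^bsub>B\<^esub>) \<notin> Q" using one_idempotent_in_prime[OF that] by simp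
    then show ?thesis by (rule right.unique_maximal_if_u_notin[OF pm_B that])
  next
    case False
    then show ?thesis by (rule left.unique_maximal_if_u_notin[OF pm_A that])
  qed
qed

sublocale P: pm_ring P by (rule pm_P)

sublocale spaces: open_decomposition "max_space A" "max_space B" "max_space P"
  "comap P fst" "comap P snd"
proof
  show "topspace (max_space P) =
      comap P fst ` topspace (max_space A) \<union> comap P snd ` topspace (max_space B)"
    and "comap P fst ` topspace (max_space A) \<inter> comap P snd ` topspace (max_space B) = {}"
    unfolding P.topspace_max_space A.topspace_max_space B.topspace_max_space
      left.comap_image_Max_Spec right.comap_image_Max_Spec
    using one_idempotent_in_prime P.Max_Spec_subset_Spec by auto
  show "inj_on (comap P fst) (topspace (max_space A))" "inj_on (comap P snd) (topspace (max_space B))"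
    using left.inj_on_comap right.inj_on_comap
    by (simp_all only: A.topspace_max_space B.topspace_max_space)
qed (rule left.continuous_map_comap left.open_map_comap right.continuous_map_comap right.open_map_comap)+


lemma smult_closed_P: "r \<in> carrier K \<Longrightarrow> x \<in> carrier P \<Longrightarrow> r \<odot>\<^bsub>P\<^esub> x \<in> carrier P"
  using algebra_A algebra_B
  by (auto simp: Module.algebra_def intro!: module.smult_closed)

lemma prod_alg_End:
  assumes f: "f \<in> alg_End K A" and g: "g \<in> alg_End K B"
  shows "(\<lambda>x \<in> carrier P. (f (fst x), g (snd x))) \<in> alg_End K P"
proof -
  note fD = alg_EndD[OF f] and gD = alg_EndD[OF g]
  have "(\<lambda>x \<in> carrier P. (f (fst x), g (snd x))) \<in> ring_hom P P"
    using ring_hom_closed[OF fD(1)] ring_hom_closed[OF gD(1)] ring_hom_mult[OF fD(1)]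
      ring_hom_mult[OF gD(1)] ring_hom_add[OF fD(1)] ring_hom_add[OF gD(1)]
      ring_hom_one[OF fD(1)] ring_hom_one[OF gD(1)]
    by (intro ring_hom_memI) auto
  moreover have "r \<odot>\<^bsub>A\<^esub> a \<in> carrier A" "r \<odot>\<^bsub>B\<^esub> b \<in> carrier B"
    if "r \<in> carrier K" "a \<in> carrier A" "b \<in> carrier B" for r a b
    using smult_closed_P[of r "(a, b)"] that by simp_all
  ultimately show ?thesis
    unfolding alg_End_def using fD(3) gD(3) by auto
qed

lemma spectral_map_prod_left:
  assumes g: "g \<in> alg_End K A" and f: "f \<in> ring_hom P P"
    and fg: "\<And>x. x \<in> carrier P \<Longrightarrow> fst (f x) = g (fst x)" and M: "M \<in> Max_Spec A"
  shows "spectral_map P f (comap P fst M) = comap P fst (spectral_map A g M)"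
  using left.spectral_map_comap[OF pm_P pm_A alg_EndD(1)[OF g] _ M] ring_hom_closed[OF f] fg by blast

lemma spectral_map_prod_right:
  assumes g: "g \<in> alg_End K B" and f: "f \<in> ring_hom P P"
    and fg: "\<And>x. x \<in> carrier P \<Longrightarrow> snd (f x) = g (snd x)" and M: "M \<in> Max_Spec B"
  shows "spectral_map P f (comap P snd M) = comap P snd (spectral_map B g M)"
  using right.spectral_map_comap[OF pm_P pm_B alg_EndD(1)[OF g] _ M] ring_hom_closed[OF f] fg by blast

lemma left_part_spectral_map:
  assumes g: "g \<in> alg_End K A" and f: "f \<in> ring_hom P P"
    and fg: "\<And>x. x \<in> carrier P \<Longrightarrow> fst (f x) = g (fst x)" 
  shows "spaces.left_part (spectral_map P f) = spectral_map A g"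
proof (rule extensionalityI[where A = "Max_Spec A"])
  show "spaces.left_part (spectral_map P f) \<in> extensional (Max_Spec A)"
    by (simp add: spaces.left_part_def A.topspace_max_space)
  fix M assume M: "M \<in> Max_Spec A"
  then show "spaces.left_part (spectral_map P f) M = spectral_map A g M"
    using spectral_map_prod_left[OF assms M] A.spectral_map_in_Max_Spec[OF alg_EndD(1)[OF g] M]
      left.inj_on_comap
    by (simp add: spaces.left_part_def A.topspace_max_space)
qed (rule spectral_map_extensional)

lemma right_part_spectral_map:
  assumes g: "g \<in> alg_End K B" and f: "f \<in> ring_hom P P"
    and fg: "\<And>x. x \<in> carrier P \<Longrightarrow> snd (f x) = g (snd x)" 
  shows "spaces.right_part (spectral_map P f) = spectral_map B g"
proof (rule extensionalityI[where A = "Max_Spec B"])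
  show "spaces.right_part (spectral_map P f) \<in> extensional (Max_Spec B)"
    by (simp add: spaces.right_part_def B.topspace_max_space)
  fix M assume M: "M \<in> Max_Spec B"
  then show "spaces.right_part (spectral_map P f) M = spectral_map B g M"
    using spectral_map_prod_right[OF assms M] B.spectral_map_in_Max_Spec[OF alg_EndD(1)[OF g] M]
      right.inj_on_comap
    by (simp add: spaces.right_part_def B.topspace_max_space)
qed (rule spectral_map_extensional)

text \<open>
  The spectral maps of the product that preserve both copies are the pairs of spectral maps of the
  factors. From left to right, preservation of the copies makes the endomorphism split; from right to
  left, any two endomorphisms have a product.
\<close>

lemma spectral_map_split_iff:
  assumes g: "g \<in> spaces.split_maps"
  shows "g \<in> spectral_map P ` alg_End K P \<longleftrightarrow>
    spaces.left_part g \<in> spectral_map A ` alg_End K A \<and>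
    spaces.right_part g \<in> spectral_map B ` alg_End K B"
proof
  assume "g \<in> spectral_map P ` alg_End K P"
  then obtain f where f: "f \<in> alg_End K P" and gf: "g = spectral_map P f" by blast
  note fP = alg_EndD(1)[OF f]
  have "(\<one>\<^bsub>A\<^esub>, \<zero>\<^bsub>B\<^esub>) \<notin> spectral_map P f M" if "M \<in> Max_Spec P" "(\<one>\<^bsub>A\<^esub>, \<zero>\<^bsub>B\<^esub>) \<notin> M" for M
  proof -
    have "M \<in> comap P fst ` Max_Spec A" using that left.comap_image_Max_Spec by simp
    then have "spectral_map P f M \<in> comap P fst ` Max_Spec A"
      using g unfolding gf spaces.split_maps_def A.topspace_max_space by blast
    then show ?thesis using left.comap_image_Max_Spec by simp
  qed
  note kerA = left.preserves_kernel[OF pm_P fP this]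
  have "(\<zero>\<^bsub>A\<^esub>, \<one>\<^bsub>B\<^esub>) \<notin> spectral_map P f M" if "M \<in> Max_Spec P" "(\<zero>\<^bsub>A\<^esub>, \<one>\<^bsub>B\<^esub>) \<notin> M" for M
  proof -
    have "M \<in> comap P snd ` Max_Spec B" using that right.comap_image_Max_Spec by simp
    then have "spectral_map P f M \<in> comap P snd ` Max_Spec B"
      using g unfolding gf spaces.split_maps_def B.topspace_max_space by blast
    then show ?thesis using right.comap_image_Max_Spec by simp
  qed
  note kerB = right.preserves_kernel[OF pm_P fP this]
  obtain f1 where f1: "f1 \<in> alg_End K A" "\<And>x. x \<in> carrier P \<Longrightarrow> fst (f x) = f1 (fst x)"
    by (rule induced_alg_End[OF left.ring_factor_axioms f smult_closed_P _ kerA]) auto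
  obtain f2 where f2: "f2 \<in> alg_End K B" "\<And>x. x \<in> carrier P \<Longrightarrow> snd (f x) = f2 (snd x)"
    by (rule induced_alg_End[OF right.ring_factor_axioms f smult_closed_P _ kerB]) auto
  have "spaces.left_part g = spectral_map A f1"
    unfolding gf by (rule left_part_spectral_map[OF f1(1) fP]) (rule f1(2))
  moreover have "spaces.right_part g = spectral_map B f2"
    unfolding gf by (rule right_part_spectral_map[OF f2(1) fP]) (rule f2(2))
  ultimately show "spaces.left_part g \<in> spectral_map A ` alg_End K A \<and>
      spaces.right_part g \<in> spectral_map B ` alg_End K B"
    using f1(1) f2(1) by simp
next
  assume "spaces.left_part g \<in> spectral_map A ` alg_End K A \<and>
    spaces.right_part g \<in> spectral_map B ` alg_End K B"
  then obtain f1 f2 where f1: "f1 \<in> alg_End K A" "spaces.left_part g = spectral_map A f1"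
    and f2: "f2 \<in> alg_End K B" "spaces.right_part g = spectral_map B f2" by blast
  let ?f = "\<lambda>x \<in> carrier P. (f1 (fst x), f2 (snd x))"
  have f: "?f \<in> alg_End K P" by (rule prod_alg_End[OF f1(1) f2(1)])
  note fP = alg_EndD(1)[OF f]
  have "spectral_map P ?f = g"
  proof (rule extensionalityI[where A = "Max_Spec P"])
    show "g \<in> extensional (Max_Spec P)"
      using g by (simp add: spaces.split_maps_def cmaps_def P.topspace_max_space)
    fix N assume "N \<in> Max_Spec P"
    then consider M where "M \<in> Max_Spec A" "N = comap P fst M"
      | M where "M \<in> Max_Spec B" "N = comap P snd M"
      using spaces.cover unfolding P.topspace_max_space A.topspace_max_space B.topspace_max_space by blast
    then show "spectral_map P ?f N = g N"
    proof cases
      case 1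
      then show ?thesis
        using spectral_map_prod_left[OF f1(1) fP _ 1(1)] spaces.i_left_part[OF g, of M] f1(2)
        by (simp add: A.topspace_max_space)
    next
      case 2
      then show ?thesis
        using spectral_map_prod_right[OF f2(1) fP _ 2(1)] spaces.j_right_part[OF g, of M] f2(2)
        by (simp add: B.topspace_max_space)
    qed
  qed (rule spectral_map_extensional)
  then show "g \<in> spectral_map P ` alg_End K P" using f by blast
qed

theorem pi_alg_prod: "pi_alg K P \<cong> pi_alg K A \<times>\<times> pi_alg K B"
proof -
  let ?CO = "compact_open (max_space P) (max_space P)"
  let ?E = "spectral_map P ` alg_End K P"
  let ?idP = "\<lambda>x \<in> carrier P. x" and ?idA = "\<lambda>a \<in> carrier A. a" and ?idB = "\<lambda>b \<in> carrier B. b"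
  let ?\<T> = "(\<inter>) ?E ` spaces.evaluation_conditions"
  have idA: "?idA \<in> alg_End K A" and idB: "?idB \<in> alg_End K B"
    using id_alg_End algebra_A algebra_B by blast+
  have "?idP = (\<lambda>x \<in> carrier P. (?idA (fst x), ?idB (snd x)))" by auto
  then have idP: "?idP \<in> alg_End K P"
    using prod_alg_End[OF idA idB] by metis
  have parts: "spaces.left_part (spectral_map P ?idP) = spectral_map A ?idA"
    by (rule left_part_spectral_map[OF idA alg_EndD(1)[OF idP]]) auto
  have parts': "spaces.right_part (spectral_map P ?idP) = spectral_map B ?idB"
    by (rule right_part_spectral_map[OF idB alg_EndD(1)[OF idP]]) auto
  have base: "spectral_map P ?idP \<in> spaces.split_maps"
    unfolding spaces.split_maps_def P.spectral_map_id cmaps_def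
    using spaces.cover
    by (auto simp: P.topspace_max_space intro!: continuous_map_eq[OF continuous_map_id])
  \<comment> \<open>The conditions relative to the subspace of spectral maps, where they are still clopen; in
    that subspace the loops at the identity live.\<close>
  have Inter: "\<Inter>?\<T> = ?E \<inter> spaces.split_maps"
    unfolding spaces.Inter_evaluation_conditions[symmetric]
    by (auto simp: spaces.evaluation_conditions_def)
  have "pi_alg K P = fundamental_group (subtopology ?CO ?E) (spectral_map P ?idP)"
    by (simp add: pi_alg_def spectral_space_def)
  also have "\<dots> = fundamental_group (subtopology (subtopology ?CO ?E) (\<Inter>?\<T>)) (spectral_map P ?idP)"
  proof (rule fundamental_group_Inter_clopen[symmetric])
    show "openin (subtopology ?CO ?E) T \<and> closedin (subtopology ?CO ?E) T" if "T \<in> ?\<T>" for T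
      using that spaces.clopen_evaluation_conditions
      by (auto intro: openin_subtopology_Int2 closedin_subtopology_Int_closed)
    show "spectral_map P ?idP \<in> \<Inter>?\<T>" unfolding Inter using base idP by blast
  qed
  also have "subtopology (subtopology ?CO ?E) (\<Inter>?\<T>) = subtopology (subtopology ?CO spaces.split_maps) ?E"
    unfolding Inter by (simp add: subtopology_subtopology Int_ac)
  also have "fundamental_group \<dots> (spectral_map P ?idP) \<cong> pi_alg K A \<times>\<times> pi_alg K B"
    unfolding pi_alg_def
  proof (rule fundamental_group_homeomorphic_prod)
    show "homeomorphic_map (subtopology (subtopology ?CO spaces.split_maps) ?E)
        (prod_topology (spectral_space K A) (spectral_space K B))
        (\<lambda>g. (spaces.left_part g, spaces.right_part g))"
      unfolding spectral_space_def subtopology_Times[symmetric]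
    proof (rule homeomorphic_map_subtopologies_alt[OF spaces.homeomorphic_split_maps])
      fix g assume "g \<in> topspace (subtopology ?CO spaces.split_maps)"
      then have "g \<in> spaces.split_maps" by simp
      then show "(spaces.left_part g, spaces.right_part g)
          \<in> spectral_map A ` alg_End K A \<times> spectral_map B ` alg_End K B \<longleftrightarrow> g \<in> ?E"
        using spectral_map_split_iff by simp
    qed
    show "(spaces.left_part (spectral_map P ?idP), spaces.right_part (spectral_map P ?idP)) =
        (spectral_map A ?idA, spectral_map B ?idB)"
      by (simp only: parts parts')
    show "spectral_map P ?idP \<in> topspace (subtopology (subtopology ?CO spaces.split_maps) ?E)"
      using base idP by (auto simp: topspace_compact_open spaces.split_maps_def)
  qed
  finally show ?thesis .
qed

end

theorem theorem4p5:
  shows "(\<forall>(A :: (int, 'a) module) (B :: (int, 'b) module).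
            Module.algebra \<Z> A \<and> pm_ring A \<and> Module.algebra \<Z> B \<and> pm_ring B \<longrightarrow>
            pi_alg \<Z> (alg_prod A B) \<cong> pi_alg \<Z> A \<times>\<times> pi_alg \<Z> B) \<and>
         (\<forall>(A :: (real, 'a) module) (B :: (real, 'b) module).
            Module.algebra real_ring A \<and> pm_ring A \<and> Module.algebra real_ring B \<and> pm_ring B \<longrightarrow>
            pi_alg real_ring (alg_prod A B) \<cong> pi_alg real_ring A \<times>\<times> pi_alg real_ring B)"
  by (intro conjI allI impI pm_algebra_product.pi_alg_prod pm_algebra_product.intro) blast+

end
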